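(* Let $K=\mathbb{R}$ or $\mathbb{C}$ and let $\mathcal{A}:\mathcal{I}^m\to M_n(K)$ be a fast gasket (of $m$ matrices) with exponent $s_{\mathcal{A}}$. Then $0<s_{\mathcal{A}}<\infty$. Moreover, for all sufficiently large $k$, both $s_{g,k}=g_{\mathcal{A},k}^{-1}(1)$ and $s_{f,k}=f_{\mathcal{A},k}^{-1}(1)$ are uniquely defined (i.e. each of the equations $g_{\mathcal{A},k}(s)=1$ and $f_{\mathcal{A},k}(s)=1$ has a unique solution), one has $s_{g,k}\le s_{\mathcal{A}}\le s_{f,k}$, and $s_{g,k}$ and $s_{f,k}$ converge, respectively from the left and from the right, to $s_{\mathcal{A}}$ as $k\to\infty$ with speed at least logarithmic, i.e. there is a constant $a>0$ with $|s_{f,k}-s_{g,k}|\le a/\log k$ for all sufficiently large $k$.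
   Context: $M_n(K)$ carries the max norm $\|M\|=\max_{i,j}|M^i_j|$, and $B^n_r\subset M_n(K)$ is the closed ball of radius $r$ (centred at $0$) in this norm. $\mathcal{I}^m$ is the free monoid of finite words (multi-indices) in the letters $1,\dots,m$ under concatenation; its identity, the empty word, is denoted $0$. $\mathcal{J}^m$ is the set of words $i_1i_2\dots i_k$, $k\ge2$, with $i_1\ne i_2=i_3=\dots=i_k$, and $\mathcal{J}^m\cdot\mathcal{I}^m$ is the set of words $JL$ with $J\in\mathcal{J}^m$, $L\in\mathcal{I}^m$ (and similarly for other products of sets of words). A homomorphism $\mathcal{A}:\mathcal{I}^m\to M_n(K)$ is written $A_I=\mathcal{A}(I)=A_{i_1}\cdots A_{i_k}$ for $I=i_1\dots i_k$ (with $A_0$ the identity matrix). Let $N_{\mathcal{A}}(r)$ be the cardinality of the set $B^n_r\cap\mathcal{A}(\mathcal{I}^m)$; $\mathcal{A}$ is a gasket if $N_{\mathcal{A}}(r)<\infty$ for every $r>0$. Its zeta function is $\zeta_{\mathcal{A}}(s)=\sum_{I\in\mathcal{I}^m}\|A_I\|^{-s}$ and its exponent is $s_{\mathcal{A}}=\sup\{s\ge0:\zeta_{\mathcal{A}}(s)=\infty\}$. A gasket is fast if there is $c>0$ with $\|A_{IJ}\|\ge c\|A_I\|\|A_J\|$ for all $I\in\mathcal{I}^m$, $J\in\mathcal{J}^m\cdot\mathcal{I}^m$; its coefficient is $c_{\mathcal{A}}=\inf \frac{\|A_{IJ}\|}{\|A_I\|\|A_J\|}$ over all such $I,J$. For $k>0$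 define sets of words recursively by $\mathcal{Q}^0_{\mathcal{A},k}=\mathcal{J}^m$ and, for $\ell\ge1$, $\mathcal{Q}^\ell_{\mathcal{A},k}=\{J\in\mathcal{Q}^{\ell-1}_{\mathcal{A},k}:\|A_J\|>k\}\cup\left(\mathcal{J}^m\cdot\{J\in\mathcal{Q}^{\ell-1}_{\mathcal{A},k}:\|A_J\|\le k\}\right)$. This sequence is eventually constant in $\ell$; its stable value is denoted $\mathcal{Q}_{\mathcal{A},k}$. Put $f_{\mathcal{A},k}(s)=c_{\mathcal{A}}^{-s}\sum_{J\in\mathcal{Q}_{\mathcal{A},k}}\|A_J\|^{-s}$ and $g_{\mathcal{A},k}(s)=n^{-s}\sum_{J\in\mathcal{Q}_{\mathcal{A},k}}\|A_J\|^{-s}$.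
   Formalization: Assumes in addition that m ≥ 2 and that each matrix is A_I for only finitely many words I; without these the claim fails (e.g. n=1, A_1=(1), A_2=(2) gives s_A=∞; for m=1 the set J^m is empty and g=0), and both are necessary for the conclusion. *)

theory Defs
  imports "HOL-Analysis.Analysis"
begin

definition max_norm :: "'a::real_normed_field ^ 'n ^ 'n \<Rightarrow> real" where
  "max_norm M = Max {norm (M $ i $ j) | i j. True}"

definition max_cball :: "real \<Rightarrow> ('a::real_normed_field ^ 'n ^ 'n) set" where
  "max_cball r = {M. max_norm M \<le> r}"

text \<open>The free monoid on \<open>m = CARD('m)\<close> letters is \<open>'m list\<close> under \<open>@\<close>.\<close>

definition word_hom :: "('m list \<Rightarrow> 'a::real_normed_field ^ 'n ^ 'n) \<Rightarrow> bool" where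
  "word_hom A \<longleftrightarrow> A [] = mat 1 \<and> (\<forall>I J. A (I @ J) = A I ** A J)"

definition word_prod :: "'m list set \<Rightarrow> 'm list set \<Rightarrow> 'm list set" where
  "word_prod S T = {I @ J | I J. I \<in> S \<and> J \<in> T}"

definition J_words :: "'m list set" where
  "J_words = {i # replicate p j | i j p. i \<noteq> j \<and> p \<ge> 1}"

text \<open>Matrices are counted here, not words: if \<open>A\<close> has infinite fibres, e.g. if some letter is sent
  to the identity, infinitely many words may have norm at most \<open>r\<close>.\<close>

definition gasket :: "('m list \<Rightarrow> 'a::real_normed_field ^ 'n ^ 'n) \<Rightarrow> bool" where
  "gasket A \<longleftrightarrow> word_hom A \<and> (\<forall>r>0. finite (max_cball r \<inter> range A))"

definition fast_gasket :: "('m list \<Rightarrow> 'a::real_normed_field ^ 'n ^ 'n) \<Rightarrow> bool" where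
  "fast_gasket A \<longleftrightarrow> gasket A \<and>
     (\<exists>c>0. \<forall>I. \<forall>J \<in> word_prod J_words UNIV.
        max_norm (A (I @ J)) \<ge> c * max_norm (A I) * max_norm (A J))"

definition coefficient :: "('m list \<Rightarrow> 'a::real_normed_field ^ 'n ^ 'n) \<Rightarrow> real" where
  "coefficient A = Inf {max_norm (A (I @ J)) / (max_norm (A I) * max_norm (A J)) | I J.
     J \<in> word_prod J_words UNIV}"

text \<open>The series below take values in \<open>[0,\<infinity>]\<close>, so that divergence means value \<open>\<infinity>\<close>
  (over \<^typ>\<open>ennreal\<close> every family is summable). They are used only for nowhere vanishing
  \<open>A\<close>, so the convention \<open>0 powr x = 0\<close> plays no role.\<close>

definition zeta :: "('m list \<Rightarrow> 'a::real_normed_field ^ 'n ^ 'n) \<Rightarrow> real \<Rightarrow> ennreal" where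
  "zeta A s = (\<Sum>\<^sub>\<infinity>I\<in>UNIV. ennreal (max_norm (A I) powr (- s)))"

definition exponent :: "('m list \<Rightarrow> 'a::real_normed_field ^ 'n ^ 'n) \<Rightarrow> ereal" where
  "exponent A = Sup {ereal s | s. s \<ge> 0 \<and> zeta A s = \<infinity>}"

primrec Q_seq :: "('m list \<Rightarrow> 'a::real_normed_field ^ 'n ^ 'n) \<Rightarrow> real \<Rightarrow> nat \<Rightarrow> 'm list set" where
  "Q_seq A k 0 = J_words"
| "Q_seq A k (Suc l) = {J \<in> Q_seq A k l. max_norm (A J) > k}
     \<union> word_prod J_words {J \<in> Q_seq A k l. max_norm (A J) \<le> k}"

definition Q_words :: "('m list \<Rightarrow> 'a::real_normed_field ^ 'n ^ 'n) \<Rightarrow> real \<Rightarrow> 'm list set" where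
  "Q_words A k = (THE Q. eventually (\<lambda>l. Q_seq A k l = Q) sequentially)"

definition f_fun :: "('m list \<Rightarrow> 'a::real_normed_field ^ 'n ^ 'n) \<Rightarrow> real \<Rightarrow> real \<Rightarrow> ennreal" where
  "f_fun A k s = ennreal (coefficient A powr (- s)) *
     (\<Sum>\<^sub>\<infinity>J\<in>Q_words A k. ennreal (max_norm (A J) powr (- s)))"

definition g_fun :: "('m list \<Rightarrow> 'a::real_normed_field ^ 'n ^ 'n) \<Rightarrow> real \<Rightarrow> real \<Rightarrow> ennreal" where
  "g_fun A k s = ennreal (real CARD('n) powr (- s)) *
     (\<Sum>\<^sub>\<infinity>J\<in>Q_words A k. ennreal (max_norm (A J) powr (- s)))"

definition s_f :: "('m list \<Rightarrow> 'a::real_normed_field ^ 'n ^ 'n) \<Rightarrow> real \<Rightarrow> real" where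
  "s_f A k = (THE s. f_fun A k s = 1)"

definition s_g :: "('m list \<Rightarrow> 'a::real_normed_field ^ 'n ^ 'n) \<Rightarrow> real \<Rightarrow> real" where
  "s_g A k = (THE s. g_fun A k s = 1)"

end

theory Submission
  imports Defs "HOL-Computational_Algebra.Fundamental_Theorem_Algebra"
begin

text \<open>Cutting words from the right at suffixes in \<open>Q = Q_words A k\<close> is unambiguous, since \<open>Q\<close> is a
  suffix code, and it leaves a remainder \<open>replicate p i @ U\<close> with \<open>U\<close> in a finite set. With
  \<open>c N(W) N(q) \<le> N(W @ q) \<le> n N(W) N(q)\<close> this gives \<open>\<zeta> \<ge> 1 + g \<zeta>\<close> and \<open>\<zeta> \<le> e + f \<zeta>\<close>, so the exponent
  lies between the roots of \<open>g = 1\<close> and \<open>f = 1\<close>. All words of \<open>Q\<close> have norm above \<open>k\<close>, so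
  \<open>f (s + t) \<le> (c k) powr (- t) * f s\<close>; as \<open>f s = (n / c) powr s * g s\<close>, this bounds the distance
  of the roots by \<open>O (1 / ln k)\<close>.

  The roots exist because the sum over \<open>Q\<close> diverges at its abscissa of convergence \<open>\<sigma>\<close>. Since
  \<open>Q\<close> differs from \<open>J_words\<close> only by finitely many suffixes, it is enough to see this for the words
  \<open>i j j \<dots> j\<close>. Their matrices satisfy a linear recurrence, so their norms either grow
  exponentially (\<open>\<sigma> = 0\<close>) or are comparable to \<open>p ^ d\<close> with \<open>d > 0\<close> (\<open>\<sigma> = 1 / d\<close>, a harmonic
  series).\<close>

subsection \<open>Linear recurrences\<close>

text \<open>This is \<open>q(E) y\<close> for the shift operator \<open>E\<close>. Products of
  polynomials become compositions (\<open>shift_op_mult\<close>), so a linear recurrence says that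
  \<open>y\<close> is annihilated by its characteristic polynomial, and the factors of that
  polynomial can be treated one at a time.\<close>

definition shift_op :: "complex poly \<Rightarrow> (nat \<Rightarrow> complex) \<Rightarrow> nat \<Rightarrow> complex" where
  "shift_op q y p = (\<Sum>i\<le>degree q. coeff q i * y (p + i))"

text \<open>The base \<open>real p + 1\<close> keeps the bound meaningful at \<open>p = 0\<close>,
  so it can be stated for all \<open>p\<close> and not only eventually.\<close>

definition poly_bounded :: "nat \<Rightarrow> (nat \<Rightarrow> complex) \<Rightarrow> bool" where
  "poly_bounded d y \<longleftrightarrow> (\<exists>C. \<forall>p. norm (y p) \<le> C * (real p + 1) ^ d)"

lemma shift_op_0 [simp]: "shift_op 0 y p = 0"
  by (simp add: shift_op_def)

lemma shift_op_pCons [simp]: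
  "shift_op (pCons a q) y p = a * y p + shift_op q y (Suc p)"
proof (cases "q = 0")
  case False
  then show ?thesis
    by (simp add: shift_op_def sum.atMost_Suc_shift del: sum.atMost_Suc)
qed (simp add: shift_op_def)

lemma shift_op_smult: "shift_op (smult c q) y p = c * shift_op q y p"
  by (induction q arbitrary: p) (auto simp: algebra_simps)

lemma shift_op_add: "shift_op (q + r) y p = shift_op q y p + shift_op r y p"
proof (induction q arbitrary: r p)
  case (pCons a q)
  show ?case
  proof (cases r)
    case (pCons b s)
    then show ?thesis using pCons.IH[of s] by (simp add: algebra_simps)
  qed
qed simp

lemma shift_op_mult: "shift_op (q * r) y p = shift_op q (shift_op r y) p"
  by (induction q arbitrary: p) (simp_all add: shift_op_add shift_op_smult)

lemma shift_op_diff_fun: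
  "shift_op q (\<lambda>p. y p - z p) p = shift_op q y p - shift_op q z p"
  by (induction q arbitrary: p) (simp_all add: algebra_simps)

lemma poly_boundedI: "(\<And>p. norm (y p) \<le> C * (real p + 1) ^ d) \<Longrightarrow> poly_bounded d y"
  unfolding poly_bounded_def by blast

lemma poly_boundedE:
  assumes "poly_bounded d y"
  obtains C where "C \<ge> 0" "\<And>p. norm (y p) \<le> C * (real p + 1) ^ d"
proof -
  obtain C where C: "\<And>p. norm (y p) \<le> C * (real p + 1) ^ d"
    using assms unfolding poly_bounded_def by blast
  have "C \<ge> 0" using order_trans[OF norm_ge_zero C[of 0]] by simp
  then show ?thesis using that C by blast
qed

lemma poly_bounded_0: "poly_bounded d (\<lambda>p. 0)"
  by (rule poly_boundedI[where C = 0]) simp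

lemma poly_bounded_add:
  assumes "poly_bounded d y" "poly_bounded d z"
  shows "poly_bounded d (\<lambda>p. y p + z p)"
proof -
  obtain C D where C: "\<And>p. norm (y p) \<le> C * (real p + 1) ^ d" "\<And>p. norm (z p) \<le> D * (real p + 1) ^ d"
    using assms by (metis poly_boundedE)
  show ?thesis
    by (rule poly_boundedI[where C = "C + D"])
      (metis C add_mono distrib_right norm_triangle_le)
qed

lemma poly_bounded_cmult:
  assumes "poly_bounded d y"
  shows "poly_bounded d (\<lambda>p. c * y p)"
proof -
  obtain C where C: "\<And>p. norm (y p) \<le> C * (real p + 1) ^ d"
    using assms by (metis poly_boundedE)
  show ?thesis
    by (rule poly_boundedI[where C = "norm c * C"])
      (simp add: norm_mult C mult_left_mono mult.assoc)
qed

lemma poly_bounded_diff: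
  assumes "poly_bounded d y" "poly_bounded d z"
  shows "poly_bounded d (\<lambda>p. y p - z p)"
  using poly_bounded_add[OF assms(1) poly_bounded_cmult[OF assms(2), of "-1"]] by simp

lemma poly_bounded_mono:
  assumes "poly_bounded d y" "d \<le> e"
  shows "poly_bounded e y"
proof -
  obtain C where C: "C \<ge> 0" "\<And>p. norm (y p) \<le> C * (real p + 1) ^ d"
    using assms by (metis poly_boundedE)
  show ?thesis
  proof (rule poly_boundedI[where C = C])
    fix p
    have "(real p + 1) ^ d \<le> (real p + 1) ^ e"
      by (rule power_increasing) (use assms in auto)
    then show "norm (y p) \<le> C * (real p + 1) ^ e"
      using C by (meson mult_left_mono order_trans)
  qed
qed

lemma poly_bounded_Suc:
  assumes "poly_bounded d y"
  shows "poly_bounded d (\<lambda>p. y (Suc p))"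
proof -
  obtain C where C: "C \<ge> 0" "\<And>p. norm (y p) \<le> C * (real p + 1) ^ d"
    using assms by (metis poly_boundedE)
  show ?thesis
  proof (rule poly_boundedI[where C = "C * 2 ^ d"])
    fix p
    have "(real (Suc p) + 1) ^ d \<le> (2 * (real p + 1)) ^ d"
      by (rule power_mono) auto
    then have "C * (real (Suc p) + 1) ^ d \<le> C * 2 ^ d * (real p + 1) ^ d"
      using C(1) mult_left_mono by (metis mult.assoc power_mult_distrib)
    then show "norm (y (Suc p)) \<le> C * 2 ^ d * (real p + 1) ^ d"
      using C(2)[of "Suc p"] by linarith
  qed
qed

lemma poly_bounded_shift_op:
  assumes "poly_bounded d y"
  shows "poly_bounded d (shift_op q y)"
proof (induction q)
  case 0
  then show ?case by (simp add: poly_bounded_0 shift_op_def)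
next
  case (pCons a q)
  then show ?case
    using poly_bounded_add[OF poly_bounded_cmult[OF assms] poly_bounded_Suc[OF pCons(2)], of a]
    by (simp add: poly_bounded_def)
qed

lemma shift_op_linear: "shift_op [:-l, 1:] y p = y (Suc p) - l * y p"
  by simp

lemma shift_op_const: "shift_op [:c:] y p = c * y p"
  by simp

text \<open>Euclidean division by \<open>X - l\<close> recovers \<open>q(l) y\<close> from \<open>q(E) y\<close> and \<open>(E - l) y\<close>.\<close>

lemma poly_bounded_coprime:
  assumes "poly_bounded d (shift_op ([:-l, 1:] ^ v) y)" "poly_bounded d (shift_op q y)" "poly q l \<noteq> 0"
  shows "poly_bounded d y"
  using assms(1,2)
proof (induction v arbitrary: y)
  case 0
  then show ?case by (simp add: shift_op_const one_pCons cong: poly_bounded_def)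
next
  case (Suc v)
  \<comment> \<open>The sequence \<open>z = (E - l) y\<close> needs one factor less, and
    \<open>q(E) z = (E - l) (q(E) y)\<close> is still bounded, so the induction hypothesis applies
    to it.\<close>
  define z where "z = shift_op [:-l, 1:] y"
  have "shift_op ([:-l, 1:] ^ v) z = shift_op ([:-l, 1:] ^ Suc v) y"
    unfolding z_def by (rule ext) (simp only: shift_op_mult power_Suc2)
  moreover have "shift_op q z = shift_op [:-l, 1:] (shift_op q y)"
    unfolding z_def by (rule ext) (simp only: shift_op_mult[symmetric] mult.commute)
  ultimately have z: "poly_bounded d z"
    using Suc.IH[of z] Suc.prems by (simp add: poly_bounded_shift_op del: shift_op_pCons)
  define h where "h = synthetic_div q l"
  have "q = h * [:-l, 1:] + [:poly q l:]"
    unfolding h_def by (metis synthetic_div_correct' mult.commute)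
  then have "shift_op q y p = shift_op h z p + poly q l * y p" for p
    unfolding z_def shift_op_mult[symmetric] shift_op_const[symmetric] shift_op_add[symmetric] by simp
  then have "y = (\<lambda>p. (1 / poly q l) * (shift_op q y p - shift_op h z p))"
    using assms(3) by (auto simp: field_simps)
  moreover have "poly_bounded d (\<lambda>p. (1 / poly q l) * (shift_op q y p - shift_op h z p))"
    by (intro poly_bounded_cmult poly_bounded_diff poly_bounded_shift_op Suc.prems z)
  ultimately show ?case by simp
qed

text \<open>Here \<open>y (p + 1)\<close> equals \<open>l * y p\<close> up to an error of degree
  \<open>d\<close>. For \<open>norm l < 1\<close> the contraction absorbs the errors; for
  \<open>norm l \<le> 1\<close> they add up over \<open>p\<close> steps and cost one degree.\<close>

lemma poly_bounded_linear_root: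
  assumes "poly_bounded d (shift_op [:-l, 1:] y)"
  shows "norm l < 1 \<Longrightarrow> poly_bounded d y"
    and "norm l \<le> 1 \<Longrightarrow> poly_bounded (Suc d) y"
proof -
  obtain C where C: "C \<ge> 0" "\<And>p. norm (y (Suc p) - l * y p) \<le> C * (real p + 1) ^ d"
    using assms by (metis poly_boundedE shift_op_linear)
  have step: "norm (y (Suc p)) \<le> norm l * norm (y p) + C * (real p + 1) ^ d" for p
    using C(2)[of p] norm_triangle_ineq[of "y (Suc p) - l * y p" "l * y p"] by (simp add: norm_mult)
  show "poly_bounded d y" if l: "norm l < 1"
  proof -
    \<comment> \<open>Chosen so that the bound holds at \<open>p = 0\<close> and
      \<open>norm l * D + C \<le> D\<close>, which makes it reproduce itself.\<close>
    define D where "D = norm (y 0) + C / (1 - norm l)"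
    have D: "D \<ge> 0" "D \<ge> norm (y 0)" using C l by (auto simp: D_def)
    have "C / (1 - norm l) * (1 - norm l) \<le> D * (1 - norm l)"
      by (rule mult_right_mono) (use l in \<open>auto simp: D_def\<close>)
    then have "C \<le> D * (1 - norm l)" using l by simp
    then have DC: "norm l * D + C \<le> D" by (simp add: algebra_simps)
    show ?thesis
    proof (rule poly_boundedI[where C = D])
      fix p show "norm (y p) \<le> D * (real p + 1) ^ d"
      proof (induction p)
        case (Suc p)
        have "norm (y (Suc p)) \<le> norm l * (D * (real p + 1) ^ d) + C * (real p + 1) ^ d"
          using step[of p] Suc by (meson add_mono order_trans mult_left_mono norm_ge_zero order_refl)
        also have "\<dots> = (norm l * D + C) * (real p + 1) ^ d" by (simp add: algebra_simps)
        also have "\<dots> \<le> D * (real p + 1) ^ d" by (rule mult_right_mono[OF DC]) auto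
        also have "\<dots> \<le> D * (real (Suc p) + 1) ^ d"
          by (intro mult_left_mono power_mono D) auto
        finally show ?case .
      qed (use D in auto)
    qed
  qed
  show "poly_bounded (Suc d) y" if l: "norm l \<le> 1"
  proof (rule poly_boundedI[where C = "norm (y 0) + C"])
    fix p show "norm (y p) \<le> (norm (y 0) + C) * (real p + 1) ^ Suc d"
    proof (induction p)
      case (Suc p)
      have "norm (y (Suc p)) \<le> norm (y p) + C * (real p + 1) ^ d"
        using step[of p] mult_right_mono[OF l norm_ge_zero[of "y p"]] by simp
      also have "\<dots> \<le> (norm (y 0) + C) * (real p + 1) ^ Suc d + (norm (y 0) + C) * (real p + 1) ^ d"
        by (intro add_mono Suc mult_right_mono) auto
      also have "\<dots> = (norm (y 0) + C) * ((real p + 2) * (real p + 1) ^ d)" by (simp add: algebra_simps)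
      also have "\<dots> \<le> (norm (y 0) + C) * ((real p + 2) * (real p + 2) ^ d)"
        by (intro mult_left_mono power_mono) (use C in auto)
      finally show ?case by (simp add: algebra_simps)
    qed (use C in auto)
  qed
qed

text \<open>On the unit circle each factor \<open>E - l\<close> costs one degree, except the
  innermost one: a solution of \<open>(E - l) y = 0\<close> is geometric and hence bounded. This
  gives the bound \<open>v \<le> Suc d\<close>. Inside the disc no factor costs anything.\<close>

lemma poly_bounded_power_root:
  assumes "\<And>p. shift_op ([:-l, 1:] ^ v) y p = 0" "norm l \<le> 1" "norm l < 1 \<or> v \<le> Suc d"
  shows "poly_bounded d y"
  using assms(1,3)
proof (induction v arbitrary: y d)
  case 0
  then have "y = (\<lambda>p. 0)" by (auto simp: one_pCons)
  then show ?case by (simp add: poly_bounded_0)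
next
  case (Suc v)
  define z where "z = shift_op [:-l, 1:] y"
  have z: "shift_op ([:-l, 1:] ^ v) z p = 0" for p
    using Suc.prems(1)[of p] unfolding z_def power_Suc2 shift_op_mult .
  show ?case
  proof (cases "norm l < 1")
    case True
    then show ?thesis using Suc.IH[OF z, of d] poly_bounded_linear_root(1) z_def by blast
  next
    case False
    then have v: "v \<le> d" using Suc.prems by auto
    show ?thesis
    proof (cases v)
      case 0
      then have "z = (\<lambda>p. 0)" using z by (auto simp: one_pCons)
      then have s: "y (Suc p) = l * y p" for p
        unfolding z_def fun_eq_iff shift_op_linear by simp
      have "norm (y p) \<le> norm (y 0)" for p
        by (induction p) (use s assms(2) in \<open>auto simp: norm_mult intro: order_trans[OF mult_right_mono]\<close>)
      then have "poly_bounded 0 y" by (intro poly_boundedI[where C = "norm (y 0)"]) auto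
      then show ?thesis using poly_bounded_mono by blast
    next
      case (Suc w)
      then obtain e where e: "d = Suc e" "v \<le> Suc e" using v by (cases d) auto
      then show ?thesis using Suc.IH[OF z, of e] poly_bounded_linear_root(2) z_def assms(2) by blast
    qed
  qed
qed

text \<open>Split \<open>q = (X - l) ^ v * r\<close> with \<open>r(l)\<close> nonzero. The induction
  hypothesis bounds \<open>(E - l) ^ v y\<close>, which \<open>r\<close> annihilates;
  \<open>poly_bounded_power_root\<close> bounds \<open>r(E) y\<close>, which
  \<open>(X - l) ^ v\<close> annihilates; coprimality recovers \<open>y\<close>.\<close>

lemma poly_bounded_annihilated:
  assumes "q \<noteq> 0" "\<And>p. shift_op q y p = 0"
    and "\<And>l. poly q l = 0 \<Longrightarrow> norm l < 1 \<or> norm l = 1 \<and> order l q \<le> Suc d"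
  shows "poly_bounded d y"
  using assms
proof (induction "degree q" arbitrary: q y rule: less_induct)
  case less
  show ?case
  proof (cases "degree q = 0")
    case True
    then obtain c where "q = [:c:]" "c \<noteq> 0" using less.prems(1) by (metis degree_eq_zeroE pCons_0_0)
    then have "y = (\<lambda>p. 0)" using less.prems(2) by auto
    then show ?thesis by (simp add: poly_bounded_0)
  next
    case False
    then obtain l where l: "poly q l = 0"
      using fundamental_theorem_of_algebra[of q] constant_degree[of q] by metis
    define v where "v = order l q"
    have v: "v > 0" using l less.prems(1) by (simp add: v_def order_root)
    obtain r where r: "q = [:-l, 1:] ^ v * r" "poly r l \<noteq> 0"
      using order_decomp[OF less.prems(1), of l] by (auto simp: v_def poly_eq_0_iff_dvd)
    have "r \<noteq> 0" using r by auto
    then have deg: "degree r < degree q"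
      using v unfolding r(1) by (subst degree_mult_eq) (auto simp: degree_linear_power)
    have "poly_bounded d (shift_op ([:-l, 1:] ^ v) y)"
    proof (rule less.hyps[OF deg \<open>r \<noteq> 0\<close>])
      show "shift_op r (shift_op ([:-l, 1:] ^ v) y) p = 0" for p
        using less.prems(2)[of p] r(1) by (simp only: shift_op_mult[symmetric] mult.commute)
      fix m assume "poly r m = 0"
      then have "poly q m = 0" using r(1) by simp
      moreover have "order m r \<le> order m q"
        by (rule dvd_imp_order_le) (use less.prems(1) r(1) in auto)
      ultimately show "norm m < 1 \<or> norm m = 1 \<and> order m r \<le> Suc d"
        using less.prems(3)[of m] by auto
    qed
    moreover have "poly_bounded d (shift_op r y)"
    proof (rule poly_bounded_power_root)
      show "shift_op ([:-l, 1:] ^ v) (shift_op r y) p = 0" for p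
        using less.prems(2)[of p] r(1) by (simp only: shift_op_mult[symmetric])
    qed (use less.prems(3)[OF l] in \<open>auto simp: v_def\<close>)
    ultimately show ?thesis using r(2) poly_bounded_coprime by blast
  qed
qed

lemma geometric_of_linear_root:
  assumes "\<And>p. shift_op [:-l, 1:] y p = 0"
  shows "y p = l ^ p * y 0"
proof (induction p)
  case (Suc p)
  then show ?case using assms[of p] by (simp add: algebra_simps)
qed simp

text \<open>The model solution for a multiple root: by Pascal's rule, each \<open>E - l\<close>
  lowers the lower index of the binomial coefficient by one and releases a factor \<open>l\<close>,
  until a geometric sequence remains.\<close>

lemma shift_op_binomial:
  assumes "l \<noteq> 0"
  shows "shift_op ([:-l, 1:] ^ d) (\<lambda>p. l ^ p * k * of_nat (p choose d)) p = l ^ (p + d) * k"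
proof (induction d arbitrary: p k)
  case 0
  then show ?case by (simp add: one_pCons)
next
  case (Suc d)
  have "shift_op [:-l, 1:] (\<lambda>p. l ^ p * k * of_nat (p choose Suc d))
     = (\<lambda>p. l ^ p * (l * k) * of_nat (p choose d))"
    by (rule ext) (simp add: algebra_simps)
  then have "shift_op ([:-l, 1:] ^ Suc d) (\<lambda>p. l ^ p * k * of_nat (p choose Suc d)) p
     = shift_op ([:-l, 1:] ^ d) (\<lambda>p. l ^ p * (l * k) * of_nat (p choose d)) p"
    by (simp only: shift_op_mult power_Suc2)
  then show ?case using Suc.IH[of "l * k" p] by (simp add: algebra_simps)
qed

text \<open>Subtracting a multiple of the model solution with \<open>p choose Suc d\<close> leaves a
  sequence killed by \<open>(E - l) ^ Suc d\<close>, which has degree at most \<open>d\<close> and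
  cannot cancel the leading term.\<close>

lemma polynomial_lower_bound:
  assumes z: "\<And>p. shift_op ([:-l, 1:] ^ Suc (Suc d)) z p = 0"
    and nz: "\<exists>p. shift_op ([:-l, 1:] ^ Suc d) z p \<noteq> 0" and l: "norm l = 1"
  shows "\<exists>c>0. \<forall>\<^sub>F p in sequentially. c * real p ^ Suc d \<le> norm (z p)"
proof -
  have l0: "l \<noteq> 0" using l by auto
  define u where "u = shift_op ([:-l, 1:] ^ Suc d) z"
  have "shift_op [:-l, 1:] u p = 0" for p
    using z[of p] unfolding u_def shift_op_mult[symmetric] power_Suc[symmetric] .
  then have u: "u p = l ^ p * u 0" for p by (rule geometric_of_linear_root)
  then have u0: "u 0 \<noteq> 0" using nz by (metis u_def mult_eq_0_iff)
  \<comment> \<open>With this factor \<open>(E - l) ^ Suc d\<close> maps the model solution exactly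
    to \<open>u\<close>, because \<open>l ^ (p + Suc d) * k = l ^ p * u 0\<close>.\<close>
  define k where "k = u 0 / l ^ Suc d"
  have k0: "norm k > 0" using u0 l0 by (simp add: k_def)
  have "shift_op ([:-l, 1:] ^ Suc d) (\<lambda>p. z p - l ^ p * k * of_nat (p choose Suc d)) p = 0" for p
    unfolding shift_op_diff_fun shift_op_binomial[OF l0]
    unfolding u_def[symmetric] using u[of p] l0 by (simp add: k_def power_add)
  then have "poly_bounded d (\<lambda>p. z p - l ^ p * k * of_nat (p choose Suc d))"
    by (rule poly_bounded_power_root) (use l in simp_all)
  then obtain C where C: "C \<ge> 0" "\<And>p. norm (z p - l ^ p * k * of_nat (p choose Suc d)) \<le> C * (real p + 1) ^ d"
    by (rule poly_boundedE) blast
  \<comment> \<open>From \<open>(p choose m) \<ge> (p / m) ^ m\<close> with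
    \<open>m = Suc d\<close>. The bound \<open>P\<close> below ensures both \<open>p \<ge> m\<close>
    and that the remainder is at most half of the main term.\<close>
  define b where "b = norm k / real (Suc d) ^ Suc d"
  have b: "b > 0" unfolding b_def by (rule divide_pos_pos[OF k0]) simp
  define P where "P = nat \<lceil>2 * C * 2 ^ d / b\<rceil> + Suc d"
  have "b / 2 * real p ^ Suc d \<le> norm (z p)" if p: "p \<ge> P" for p
  proof -
    have p1: "p \<ge> Suc d" using p by (simp add: P_def)
    have pb: "real p \<ge> 2 * C * 2 ^ d / b" using p unfolding P_def by linarith
    have "norm (l ^ p * k * of_nat (p choose Suc d)) = norm k * real (p choose Suc d)"
      by (simp add: norm_mult norm_power l)
    also have "\<dots> \<ge> norm k * (real p / real (Suc d)) ^ Suc d"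
      by (intro mult_left_mono binomial_ge_n_over_k_pow_k p1) auto
    also have "norm k * (real p / real (Suc d)) ^ Suc d = b * real p ^ Suc d"
      by (simp add: b_def power_divide)
    finally have "b * real p ^ Suc d \<le> norm (z p) + C * (real p + 1) ^ d"
      using C(2)[of p] norm_triangle_ineq2[of "l ^ p * k * of_nat (p choose Suc d)" "z p"]
      by (simp add: norm_minus_commute)
    moreover have "C * (real p + 1) ^ d \<le> b / 2 * real p ^ Suc d"
    proof -
      have "C * (real p + 1) ^ d \<le> C * (2 * real p) ^ d"
        by (intro mult_left_mono power_mono C) (use p1 in auto)
      also have "\<dots> = (C * 2 ^ d) * real p ^ d" by (simp add: power_mult_distrib)
      also have "\<dots> \<le> (b / 2 * real p) * real p ^ d"
        by (rule mult_right_mono) (use pb b in \<open>auto simp: field_simps\<close>)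
      finally show ?thesis by simp
    qed
    ultimately show ?thesis by simp
  qed
  then show ?thesis using b
    by (intro exI[of _ "b / 2"]) (auto simp: eventually_sequentially)
qed

text \<open>The cases are: a root outside the unit disc, only simple roots on the unit circle, and a
  root of multiplicity \<open>d + 1 > 1\<close> on it. The lower bounds concern
  \<open>shift_op r y\<close> instead of \<open>y\<close>, because \<open>r\<close> removes the
  other roots, whose contributions could cancel in \<open>y\<close> for infinitely many
  \<open>p\<close>.\<close>

lemma recurrence_trichotomy:
  assumes "q \<noteq> 0" "\<And>p. shift_op q y p = 0"
  shows "(\<exists>r c \<rho>. c > 0 \<and> \<rho> > 1 \<and> (\<forall>p. c * \<rho> ^ p \<le> norm (shift_op r y p)))
    \<or> poly_bounded 0 y
    \<or> (\<exists>d>0. poly_bounded d y \<and>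
        (\<exists>r c. c > 0 \<and> (\<forall>\<^sub>F p in sequentially. c * real p ^ d \<le> norm (shift_op r y p))))"
proof -
  \<comment> \<open>For an annihilator \<open>q\<close> of least degree every root of \<open>q\<close> really contributes to \<open>y\<close>.\<close>
  define ann where "ann q \<longleftrightarrow> q \<noteq> 0 \<and> (\<forall>p. shift_op q y p = 0)" for q
  obtain q where q: "ann q" and min: "\<And>r. ann r \<Longrightarrow> degree q \<le> degree r"
    using assms exists_least_iff[of "\<lambda>k. \<exists>q. ann q \<and> degree q = k"]
    by (metis ann_def not_less)
  have q0: "q \<noteq> 0" and qy: "shift_op q y p = 0" for p using q by (auto simp: ann_def)
  have not_ann: "\<exists>p. shift_op r y p \<noteq> 0" if "degree r < degree q" "r \<noteq> 0" for r
    using min[of r] that unfolding ann_def by force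
  show ?thesis
  proof (cases "\<exists>l. poly q l = 0 \<and> norm l > 1")
    case True
    then obtain l where l: "poly q l = 0" "norm l > 1" by auto
    then obtain r where r: "q = [:-l, 1:] * r" by (auto simp: poly_eq_0_iff_dvd elim: dvdE)
    then have r0: "r \<noteq> 0" using q0 by auto
    have "degree r < degree q" unfolding r by (subst degree_mult_eq) (use r0 in auto)
    then obtain p where p: "shift_op r y p \<noteq> 0" using not_ann r0 by blast
    have geo: "shift_op r y p = l ^ p * shift_op r y 0" for p
      by (rule geometric_of_linear_root) (use qy r in \<open>simp only: shift_op_mult[symmetric]\<close>)
    then have "shift_op r y 0 \<noteq> 0" using p by (metis mult_eq_0_iff)
    moreover have "norm (shift_op r y 0) * norm l ^ p \<le> norm (shift_op r y p)" for p
      by (subst (2) geo) (simp add: norm_mult norm_power)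
    ultimately show ?thesis using l(2) by (meson zero_less_norm_iff)
  next
    case False
    then have roots: "norm l < 1 \<or> norm l = 1" if "poly q l = 0" for l using that by force
    define M where "M = {order l q | l. poly q l = 0 \<and> norm l = 1}"
    have fin: "finite M"
      unfolding M_def using poly_roots_finite[OF q0] by simp
    show ?thesis
    proof (cases "\<forall>\<mu>\<in>M. \<mu> \<le> 1")
      case True
      have "poly_bounded 0 y"
        by (rule poly_bounded_annihilated[OF q0 qy]) (use roots True in \<open>auto simp: M_def\<close>)
      then show ?thesis by blast
    next
      case False
      define \<mu> where "\<mu> = Max M"
      have M: "M \<noteq> {}" using False by auto
      have \<mu>: "\<mu> \<in> M" "\<And>v. v \<in> M \<Longrightarrow> v \<le> \<mu>"
        using Max_in[OF fin M] Max_ge[OF fin] by (auto simp: \<mu>_def)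
      obtain d where d: "\<mu> = Suc (Suc d)"
        using False \<mu>(2) by (metis One_nat_def Suc_le_mono le_0_eq not0_implies_Suc order.trans zero_le)
      have "poly_bounded (Suc d) y"
        by (rule poly_bounded_annihilated[OF q0 qy]) (use roots \<mu>(2) d in \<open>auto simp: M_def\<close>)
      moreover obtain l where l: "poly q l = 0" "norm l = 1" "order l q = Suc (Suc d)"
        using \<mu>(1) d by (auto simp: M_def)
      obtain r where r: "q = [:-l, 1:] ^ Suc (Suc d) * r"
        using order_decomp[OF q0, of l] l(3) by auto
      then have r0: "r \<noteq> 0" using q0 by auto
      \<comment> \<open>With one factor \<open>X - l\<close> removed the polynomial has smaller
        degree than \<open>q\<close>, so by minimality it does not annihilate \<open>y\<close>: the
        full multiplicity of \<open>l\<close> is visible in \<open>r(E) y\<close>.\<close>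
      have "degree ([:-l, 1:] ^ Suc d * r) < degree q"
        unfolding r using r0
        by (subst (1 2) degree_mult_eq) (auto simp: degree_linear_power simp del: power_Suc)
      then obtain p where p: "shift_op ([:-l, 1:] ^ Suc d * r) y p \<noteq> 0" using not_ann r0
        by (metis mult_eq_0_iff pCons_eq_0_iff power_not_zero zero_neq_one)
      have "\<exists>c>0. \<forall>\<^sub>F p in sequentially. c * real p ^ Suc d \<le> norm (shift_op r y p)"
      proof (rule polynomial_lower_bound[OF _ _ l(2)])
        show "shift_op ([:-l, 1:] ^ Suc (Suc d)) (shift_op r y) p = 0" for p
          using qy[of p] unfolding r shift_op_mult .
        show "\<exists>p. shift_op ([:-l, 1:] ^ Suc d) (shift_op r y) p \<noteq> 0"
          using p unfolding shift_op_mult by blast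
      qed
      ultimately show ?thesis by blast
    qed
  qed
qed

lemma shift_op_monom: "shift_op (monom c i) y p = c * y (p + i)"
  by (induction i arbitrary: p) (auto simp: monom_0 monom_Suc)

lemma shift_op_sum: "shift_op (\<Sum>i\<in>S. q i) y p = (\<Sum>i\<in>S. shift_op (q i) y p)"
  by (induction S rule: infinite_finite_induct) (auto simp: shift_op_add)

text \<open>Transfers lower bounds for a filtered coordinate to \<open>norm (x p)\<close> at the
  same index. The operator looks ahead by up to \<open>degree r\<close> places, and the growth bound
  \<open>L\<close> brings those terms back to \<open>x p\<close>.\<close>

lemma norm_shift_op_le:
  fixes x :: "nat \<Rightarrow> 'v::euclidean_space"
  assumes L: "\<And>p. norm (x (Suc p)) \<le> L * norm (x p)" and b: "b \<in> Basis"
  shows "\<exists>K>0. \<forall>p. norm (shift_op r (\<lambda>p. of_real (x p \<bullet> b)) p) \<le> K * norm (x p)"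
proof (induction r)
  case 0
  then show ?case by (auto intro!: exI[of _ 1])
next
  case (pCons a r)
  then obtain K where K: "K > 0" "\<And>p. norm (shift_op r (\<lambda>p. of_real (x p \<bullet> b)) p) \<le> K * norm (x p)"
    by blast
  have "norm (shift_op (pCons a r) (\<lambda>p. of_real (x p \<bullet> b)) p) \<le> (norm a + K * (\<bar>L\<bar> + 1)) * norm (x p)" for p
  proof -
    have "norm (x (Suc p)) \<le> (\<bar>L\<bar> + 1) * norm (x p)"
      by (rule order_trans[OF L mult_right_mono]) auto
    then have "K * norm (x (Suc p)) \<le> K * ((\<bar>L\<bar> + 1) * norm (x p))"
      using K(1) by simp
    moreover have "norm a * \<bar>x p \<bullet> b\<bar> \<le> norm a * norm (x p)"
      using Basis_le_norm[OF b] by (simp add: mult_left_mono)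
    moreover have "norm (shift_op (pCons a r) (\<lambda>p. of_real (x p \<bullet> b)) p)
        \<le> norm a * \<bar>x p \<bullet> b\<bar> + norm (shift_op r (\<lambda>p. of_real (x p \<bullet> b)) (Suc p))"
      using norm_triangle_ineq[of "a * of_real (x p \<bullet> b)" "shift_op r (\<lambda>p. of_real (x p \<bullet> b)) (Suc p)"]
      by (simp add: norm_mult)
    ultimately show ?thesis using K(2)[of "Suc p"] by (simp add: algebra_simps)
  qed
  moreover have "norm a + K * (\<bar>L\<bar> + 1) > 0"
    using K(1) by (intro add_nonneg_pos mult_pos_pos) auto
  ultimately show ?case by blast
qed

section \<open>Series of negative powers of a growing sequence\<close>

lemma not_summable_powr_nonpos:
  fixes u :: "nat \<Rightarrow> real"
  assumes "filterlim u at_top sequentially" "s \<le> 0"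
  shows "\<not> summable (\<lambda>p. u p powr (- s))"
proof
  assume "summable (\<lambda>p. u p powr (- s))"
  then have "(\<lambda>p. u p powr (- s)) \<longlonglongrightarrow> 0" by (rule summable_LIMSEQ_zero)
  then have "\<forall>\<^sub>F p in sequentially. u p powr (- s) < 1" by (rule order_tendstoD) simp
  moreover have "\<forall>\<^sub>F p in sequentially. u p \<ge> 1" using assms(1) by (simp add: filterlim_at_top)
  ultimately have "\<forall>\<^sub>F p in sequentially. False"
  proof eventually_elim
    case (elim p)
    then show ?case using ge_one_powr_ge_zero[of "u p" "- s"] assms(2) by simp
  qed
  then show False by simp
qed

lemma summable_powr_geometric:
  fixes u :: "nat \<Rightarrow> real"
  assumes "c > 0" "\<rho> > 1" "\<And>p. c * \<rho> ^ p \<le> u p" "s > 0"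
  shows "summable (\<lambda>p. u p powr (- s))"
proof (rule summable_comparison_test')
  have "\<rho> powr (- s) < 1" using powr_less_cancel_iff[of \<rho> "- s" 0] assms by simp
  then show "summable (\<lambda>p. c powr (- s) * (\<rho> powr (- s)) ^ p)"
    by (intro summable_mult summable_geometric) simp
  fix p assume "p \<ge> (0::nat)"
  have "u p powr (- s) \<le> (c * \<rho> ^ p) powr (- s)"
    by (rule powr_mono2') (use assms in auto)
  also have "\<dots> = c powr (- s) * (\<rho> powr (- s)) ^ p"
    using assms by (simp add: powr_mult powr_realpow[symmetric] powr_powr mult.commute)
  finally show "norm (u p powr (- s)) \<le> c powr (- s) * (\<rho> powr (- s)) ^ p" by simp
qed

text \<open>Two-sided comparison with \<open>p powr (- (d * s))\<close>. The inequality is strict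
  because \<open>s = 1 / d\<close> gives the divergent harmonic series; this divergence at the
  abscissa later forces the roots to exist.\<close>

lemma summable_powr_polynomial:
  fixes u :: "nat \<Rightarrow> real"
  assumes c: "c > 0" and lower: "\<forall>\<^sub>F p in sequentially. c * real p ^ d \<le> u p"
    and upper: "\<And>p. u p \<le> C * (real p + 1) ^ d" and d: "d > 0" and s: "s > 0"
  shows "summable (\<lambda>p. u p powr (- s)) \<longleftrightarrow> s > 1 / real d"
proof
  assume sm: "s > 1 / real d"
  show "summable (\<lambda>p. u p powr (- s))"
  proof (rule summable_comparison_test_ev)
    show "summable (\<lambda>p. c powr (- s) * real p powr (- (real d * s)))"
      by (intro summable_mult) (use sm d in \<open>simp add: summable_real_powr_iff field_simps\<close>)
    show "\<forall>\<^sub>F p in sequentially. norm (u p powr (- s)) \<le> c powr (- s) * real p powr (- (real d * s))"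
      using lower eventually_gt_at_top[of 0]
    proof eventually_elim
      case (elim p)
      have "u p powr (- s) \<le> (c * real p ^ d) powr (- s)"
        by (rule powr_mono2') (use elim c s in auto)
      also have "\<dots> = c powr (- s) * real p powr (- (real d * s))"
        using c elim by (simp add: powr_mult powr_realpow[symmetric] powr_powr)
      finally show ?case by simp
    qed
  qed
next
  assume sm: "summable (\<lambda>p. u p powr (- s))"
  have upos: "\<forall>\<^sub>F p in sequentially. u p > 0"
    using lower eventually_gt_at_top[of 0]
    by eventually_elim (use c in \<open>auto intro: less_le_trans[rotated]\<close>)
  then obtain p where "u p > 0" by (meson eventually_sequentially order_refl)
  then have "C * (real p + 1) ^ d > 0" using upper[of p] by linarith
  then have C: "C > 0" by (simp add: zero_less_mult_iff)
  \<comment> \<open>The index is \<open>Suc p\<close> because the upper bound for \<open>u p\<close>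
    is in terms of \<open>real p + 1\<close>.\<close>
  have "summable (\<lambda>p. C powr (- s) * (real (Suc p)) powr (- (real d * s)))"
  proof (rule summable_comparison_test_ev[OF _ sm])
    show "\<forall>\<^sub>F p in sequentially. norm (C powr (- s) * real (Suc p) powr (- (real d * s))) \<le> u p powr (- s)"
      using upos
    proof eventually_elim
      case (elim p)
      have "C powr (- s) * real (Suc p) powr (- (real d * s)) = (C * (real p + 1) ^ d) powr (- s)"
        using C by (simp add: powr_mult powr_realpow[symmetric] powr_powr add.commute)
      also have "\<dots> \<le> u p powr (- s)"
        by (rule powr_mono2') (use elim upper s in auto)
      finally show ?case by simp
    qed
  qed
  then have "summable (\<lambda>p. real (Suc p) powr (- (real d * s)))"
    using C by (subst (asm) summable_cmult_iff) auto
  then have "summable (\<lambda>p. real p powr (- (real d * s)))"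
    using summable_Suc_iff[of "\<lambda>p. real p powr (- (real d * s))"] by simp
  then show "s > 1 / real d" using d by (simp add: summable_real_powr_iff field_simps)
qed

text \<open>Every coordinate satisfies the same scalar recurrence, read over the complex numbers so
  that the characteristic polynomial splits. One geometrically growing coordinate gives abscissa 0;
  otherwise the abscissa is \<open>1 / e\<close> for the largest degree \<open>e\<close> of a
  coordinate.\<close>

lemma abscissa_of_recurrence:
  fixes x :: "nat \<Rightarrow> 'v::euclidean_space"
  assumes a: "i0 \<le> D" "a i0 \<noteq> 0" and rec: "\<And>p. (\<Sum>i\<le>D. a i *\<^sub>R x (p + i)) = 0"
    and L: "\<And>p. norm (x (Suc p)) \<le> L * norm (x p)"
    and lim: "filterlim (\<lambda>p. norm (x p)) at_top sequentially"
  shows "\<exists>\<sigma>\<ge>0. \<forall>s. summable (\<lambda>p. norm (x p) powr (- s)) \<longleftrightarrow> s > \<sigma>"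
proof -
  define q where "q = (\<Sum>i\<le>D. monom (complex_of_real (a i)) i)"
  define y where "y b p = complex_of_real (x p \<bullet> b)" for b p
  have "coeff q i0 = of_real (a i0)"
    using a by (simp add: q_def coeff_sum coeff_monom sum.delta')
  then have q: "q \<noteq> 0" using a by auto
  have qy: "shift_op q (y b) p = 0" for b p
  proof -
    have "shift_op q (y b) p = of_real (\<Sum>i\<le>D. a i * (x (p + i) \<bullet> b))"
      by (simp add: q_def shift_op_sum shift_op_monom y_def)
    also have "(\<Sum>i\<le>D. a i * (x (p + i) \<bullet> b)) = (\<Sum>i\<le>D. a i *\<^sub>R x (p + i)) \<bullet> b"
      by (simp add: inner_sum_left)
    finally show ?thesis using rec by simp
  qed
  have growth: "\<exists>K>0. \<forall>p. norm (shift_op r (y b) p) \<le> K * norm (x p)" if "b \<in> Basis" for r b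
    unfolding y_def using norm_shift_op_le[of x L b, OF _ that] L by blast
  show ?thesis
  proof (cases "\<exists>b\<in>Basis. \<exists>r c \<rho>. c > 0 \<and> \<rho> > 1 \<and> (\<forall>p. c * \<rho> ^ p \<le> norm (shift_op r (y b) p))")
    case True
    then obtain b r c \<rho> where b: "b \<in> Basis" and c: "c > 0" "\<rho> > 1"
      and ge: "\<And>p. c * \<rho> ^ p \<le> norm (shift_op r (y b) p)" by blast
    obtain K where K: "K > 0" "\<And>p. norm (shift_op r (y b) p) \<le> K * norm (x p)"
      using growth[OF b] by blast
    have "(c / K) * \<rho> ^ p \<le> norm (x p)" for p
      using order_trans[OF ge K(2), of p] K(1) by (simp add: field_simps)
    then have "summable (\<lambda>p. norm (x p) powr (- s))" if "s > 0" for s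
      using summable_powr_geometric[of "c / K" \<rho> "\<lambda>p. norm (x p)" s] c K(1) that by simp
    then have "summable (\<lambda>p. norm (x p) powr (- s)) \<longleftrightarrow> s > 0" for s
      using not_summable_powr_nonpos[OF lim, of s] by (cases "s > 0") auto
    then show ?thesis by (intro exI[of _ 0]) simp
  next
    case False
    \<comment> \<open>The bounded case is recorded as \<open>d = 0\<close>, for which no lower bound
      is claimed.\<close>
    have "\<exists>d. poly_bounded d (y b) \<and> (d > 0 \<longrightarrow>
        (\<exists>r c. c > 0 \<and> (\<forall>\<^sub>F p in sequentially. c * real p ^ d \<le> norm (shift_op r (y b) p))))"
      if "b \<in> Basis" for b
    proof -
      have "\<not> (\<exists>r c \<rho>. c > 0 \<and> \<rho> > 1 \<and> (\<forall>p. c * \<rho> ^ p \<le> norm (shift_op r (y b) p)))"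
        using False that by blast
      then have "poly_bounded 0 (y b) \<or> (\<exists>d>0. poly_bounded d (y b) \<and>
          (\<exists>r c. c > 0 \<and> (\<forall>\<^sub>F p in sequentially. c * real p ^ d \<le> norm (shift_op r (y b) p))))"
        using recurrence_trichotomy[OF q, OF qy, of b] by argo
      then show ?thesis
      proof
        assume "poly_bounded 0 (y b)"
        then show ?thesis by (intro exI[of _ 0]) simp
      qed blast
    qed
    then obtain d where d: "\<And>b. b \<in> Basis \<Longrightarrow> poly_bounded (d b) (y b)"
      and dl: "\<And>b. b \<in> Basis \<Longrightarrow> d b > 0 \<Longrightarrow>
        \<exists>r c. c > 0 \<and> (\<forall>\<^sub>F p in sequentially. c * real p ^ d b \<le> norm (shift_op r (y b) p))"
      using bchoice[of Basis "\<lambda>b d. poly_bounded d (y b) \<and> (d > 0 \<longrightarrow>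
        (\<exists>r c. c > 0 \<and> (\<forall>\<^sub>F p in sequentially. c * real p ^ d \<le> norm (shift_op r (y b) p))))"]
      by blast
    \<comment> \<open>All coordinates obey the upper bound of degree \<open>e\<close>, while one
      attaining the maximum supplies the lower bound. Degree 0 would make \<open>x\<close> bounded,
      against \<open>lim\<close>.\<close>
    define e where "e = Max (d ` Basis)"
    have "e \<in> d ` Basis" unfolding e_def by (rule Max_in) auto
    then obtain b where b: "b \<in> Basis" "e = d b" by blast
    have "d b' \<le> e" if "b' \<in> Basis" for b' unfolding e_def by (rule Max_ge) (use that in auto)
    then have "poly_bounded e (y b')" if "b' \<in> Basis" for b' using d that poly_bounded_mono by blast
    then have "\<forall>b'\<in>Basis. \<exists>C. \<forall>p. norm (y b' p) \<le> C * (real p + 1) ^ e"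
      unfolding poly_bounded_def by blast
    then obtain C where C: "\<And>b' p. b' \<in> Basis \<Longrightarrow> norm (y b' p) \<le> C b' * (real p + 1) ^ e"
      using bchoice[of Basis "\<lambda>b' C. \<forall>p. norm (y b' p) \<le> C * (real p + 1) ^ e"] by blast
    have upper: "norm (x p) \<le> (\<Sum>b'\<in>Basis. C b') * (real p + 1) ^ e" for p
    proof -
      have "norm (x p) \<le> (\<Sum>b'\<in>Basis. \<bar>x p \<bullet> b'\<bar>)" by (rule norm_le_l1)
      also have "\<dots> \<le> (\<Sum>b'\<in>Basis. C b' * (real p + 1) ^ e)"
        by (rule sum_mono) (use C in \<open>simp add: y_def\<close>)
      finally show ?thesis by (simp add: sum_distrib_right)
    qed
    have e: "e > 0"
    proof (rule ccontr)
      assume "\<not> e > 0"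
      then have "norm (x p) \<le> (\<Sum>b'\<in>Basis. C b')" for p using upper[of p] by simp
      moreover have "\<forall>\<^sub>F p in sequentially. norm (x p) > (\<Sum>b'\<in>Basis. C b')"
        using lim by (simp add: filterlim_at_top_dense)
      ultimately have "\<forall>\<^sub>F p :: nat in sequentially. False" by (simp add: not_less[symmetric])
      then show False by simp
    qed
    then obtain r c where c: "c > 0"
      and ge: "\<forall>\<^sub>F p in sequentially. c * real p ^ e \<le> norm (shift_op r (y b) p)"
      using dl b by blast
    obtain K where K: "K > 0" "\<And>p. norm (shift_op r (y b) p) \<le> K * norm (x p)"
      using growth[OF b(1)] by blast
    have lower: "\<forall>\<^sub>F p in sequentially. (c / K) * real p ^ e \<le> norm (x p)"
      using ge
    proof eventually_elim
      case (elim p)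
      show ?case using order_trans[OF elim K(2)] K(1) by (simp add: field_simps)
    qed
    have "summable (\<lambda>p. norm (x p) powr (- s)) \<longleftrightarrow> s > 1 / real e" for s
    proof (cases "s > 0")
      case True
      then show ?thesis
        using summable_powr_polynomial[OF _ lower upper e True] c K(1) by simp
    next
      case False
      then have "\<not> s > 1 / real e" using e by (smt (verit) divide_pos_pos of_nat_0_less_iff)
      then show ?thesis using not_summable_powr_nonpos[OF lim, of s] False by simp
    qed
    then show ?thesis using e by (intro exI[of _ "1 / real e"]) auto
  qed
qed

subsection \<open>Sums in the extended nonnegative reals\<close>

lemma ennreal_summable_on: "(f :: 'b \<Rightarrow> ennreal) summable_on S"
  by (rule nonneg_summable_on_complete) simp

lemma infsum_ennreal_le:
  fixes f :: "'b \<Rightarrow> ennreal"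
  assumes "\<And>F. finite F \<Longrightarrow> F \<subseteq> S \<Longrightarrow> sum f F \<le> b"
  shows "infsum f S \<le> b"
  unfolding nonneg_infsum_complete[of S f, simplified] using assms by (auto intro!: SUP_least)

lemma sum_le_infsum_ennreal:
  fixes f :: "'b \<Rightarrow> ennreal"
  assumes "finite F" "F \<subseteq> S"
  shows "sum f F \<le> infsum f S"
  unfolding nonneg_infsum_complete[of S f, simplified] using assms by (auto intro!: SUP_upper)

lemma infsum_ennreal_mono:
  fixes f g :: "'b \<Rightarrow> ennreal"
  assumes "\<And>x. x \<in> S \<Longrightarrow> f x \<le> g x" "S \<subseteq> T"
  shows "infsum f S \<le> infsum g T"
  by (rule infsum_mono_neutral) (use assms in \<open>auto intro: ennreal_summable_on\<close>)

lemma infsum_ennreal_cmult: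
  fixes f :: "'b \<Rightarrow> ennreal"
  shows "infsum (\<lambda>x. c * f x) S = c * infsum f S"
  unfolding nonneg_infsum_complete[of S f, simplified] nonneg_infsum_complete[of S "\<lambda>x. c * f x", simplified]
  by (simp add: SUP_mult_left_ennreal sum_distrib_left)

lemma infsum_ennreal_Un_le:
  fixes f :: "'b \<Rightarrow> ennreal"
  shows "infsum f (S \<union> T) \<le> infsum f S + infsum f T"
proof -
  have "infsum f (S \<union> T) = infsum f (S \<union> (T - S))" by simp
  also have "\<dots> = infsum f S + infsum f (T - S)" by (rule infsum_Un_disjoint) (auto intro: ennreal_summable_on)
  also have "\<dots> \<le> infsum f S + infsum f T" by (intro add_left_mono infsum_ennreal_mono) auto
  finally show ?thesis .
qed

lemma infsum_ennreal_UN_le: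
  fixes f :: "'b \<Rightarrow> ennreal"
  assumes "finite I"
  shows "infsum f (\<Union>i\<in>I. S i) \<le> (\<Sum>i\<in>I. infsum f (S i))"
  using assms
proof (induction I rule: finite_induct)
  case (insert i I)
  have "infsum f (\<Union>i\<in>insert i I. S i) \<le> infsum f (S i) + infsum f (\<Union>i\<in>I. S i)"
    using infsum_ennreal_Un_le[of f "S i" "\<Union>i\<in>I. S i"] by simp
  also have "\<dots> \<le> infsum f (S i) + (\<Sum>i\<in>I. infsum f (S i))"
    by (rule add_left_mono[OF insert.IH])
  finally show ?case using insert.hyps by simp
qed simp

lemma infsum_ennreal_image_le:
  fixes f :: "'b \<Rightarrow> ennreal"
  shows "infsum f (h ` S) \<le> infsum (\<lambda>x. f (h x)) S"
proof -
  \<comment> \<open>\<open>T\<close> picks one preimage for each value of \<open>h\<close>.\<close>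
  obtain T where T: "T \<subseteq> S" "inj_on h T" "h ` T = h ` S"
    by (metis subset_image_inj order_refl)
  have "infsum f (h ` S) = infsum (\<lambda>x. f (h x)) T"
    using infsum_reindex[OF T(2), of f] T(3) by (simp add: o_def)
  also have "\<dots> \<le> infsum (\<lambda>x. f (h x)) S" by (rule infsum_ennreal_mono) (use T in auto)
  finally show ?thesis .
qed

text \<open>The outer sum is a supremum over finite sets of rows, and finitely many rows can be
  split off one by one.\<close>

lemma infsum_ennreal_Times_ge:
  fixes f :: "'b \<times> 'c \<Rightarrow> ennreal"
  shows "(\<Sum>\<^sub>\<infinity>a\<in>S. \<Sum>\<^sub>\<infinity>b\<in>T. f (a, b)) \<le> infsum f (S \<times> T)"
proof (rule infsum_ennreal_le)
  fix F assume F: "finite F" "F \<subseteq> S"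
  have "(\<Sum>a\<in>F. \<Sum>\<^sub>\<infinity>b\<in>T. f (a, b)) = infsum f (F \<times> T)"
    using F(1)
  proof (induction F rule: finite_induct)
    case (insert a F)
    have "infsum f (insert a F \<times> T) = infsum f (Pair a ` T \<union> F \<times> T)"
      by (rule arg_cong[where f = "infsum f"]) auto
    also have "\<dots> = infsum f (Pair a ` T) + infsum f (F \<times> T)"
      by (rule infsum_Un_disjoint) (use insert.hyps in \<open>auto intro: ennreal_summable_on\<close>)
    also have "infsum f (Pair a ` T) = (\<Sum>\<^sub>\<infinity>b\<in>T. f (a, b))"
      by (subst infsum_reindex) (auto simp: o_def inj_on_def)
    finally show ?case using insert by simp
  qed simp
  also have "\<dots> \<le> infsum f (S \<times> T)" by (rule infsum_ennreal_mono) (use F in auto)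
  finally show "(\<Sum>a\<in>F. \<Sum>\<^sub>\<infinity>b\<in>T. f (a, b)) \<le> infsum f (S \<times> T)" .
qed

lemma infsum_ennreal_less_top_iff_summable:
  fixes u :: "nat \<Rightarrow> real"
  assumes "\<And>p. u p \<ge> 0"
  shows "(\<Sum>\<^sub>\<infinity>p. ennreal (u p)) < \<infinity> \<longleftrightarrow> summable u"
proof
  assume s: "summable u"
  have "(\<Sum>\<^sub>\<infinity>p. ennreal (u p)) \<le> ennreal (suminf u)"
  proof (rule infsum_ennreal_le)
    fix F :: "nat set" assume "finite F"
    then show "(\<Sum>p\<in>F. ennreal (u p)) \<le> ennreal (suminf u)"
      by (simp add: assms ennreal_leI s sum_le_suminf)
  qed
  then show "(\<Sum>\<^sub>\<infinity>p. ennreal (u p)) < \<infinity>" by (simp add: le_less_trans)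
next
  assume fin: "(\<Sum>\<^sub>\<infinity>p. ennreal (u p)) < \<infinity>"
  show "summable u"
  proof (rule summableI_nonneg_bounded)
    fix p
    have "ennreal (\<Sum>i<p. u i) \<le> (\<Sum>\<^sub>\<infinity>p. ennreal (u p))"
      using sum_le_infsum_ennreal[of "{..<p}" UNIV "\<lambda>p. ennreal (u p)"] assms by simp
    then show "(\<Sum>i<p. u i) \<le> enn2real (\<Sum>\<^sub>\<infinity>p. ennreal (u p))"
      using fin by (metis enn2real_ennreal enn2real_mono assms sum_nonneg infinity_ennreal_def)
  qed (rule assms)
qed

text \<open>Termwise convexity of \<open>s \<mapsto> w powr (- s)\<close> replaces continuity of the sum on the left of the
  root; on the right it is lower semicontinuity, as the sum is a supremum of finite sums.\<close>

lemma powr_neg_convex: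
  fixes w :: real
  assumes "w > 0" "0 \<le> t" "t \<le> 1"
  shows "w powr (- (t * x + (1 - t) * y)) \<le> t * w powr (- x) + (1 - t) * w powr (- y)"
proof -
  have "exp ((1 - t) *\<^sub>R (- y * ln w) + t *\<^sub>R (- x * ln w)) \<le> (1 - t) * exp (- y * ln w) + t * exp (- x * ln w)"
    by (rule convex_onD[OF exp_convex]) (use assms in auto)
  then show ?thesis using assms(1) by (simp add: powr_def algebra_simps)
qed

text \<open>Used twice: for the strict decrease behind uniqueness of roots, and, with
  \<open>K\<close> proportional to \<open>k\<close>, for the logarithmic rate.\<close>

lemma powr_sum_decay:
  fixes w :: "'b \<Rightarrow> real"
  assumes "\<And>q. q \<in> Q \<Longrightarrow> w q \<ge> K" "K > 1" "t \<ge> 0"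
  shows "(\<Sum>\<^sub>\<infinity>q\<in>Q. ennreal (w q powr (- (s + t))))
    \<le> ennreal (K powr (- t)) * (\<Sum>\<^sub>\<infinity>q\<in>Q. ennreal (w q powr (- s)))"
  unfolding infsum_ennreal_cmult[symmetric]
proof (rule infsum_ennreal_mono)
  fix q assume q: "q \<in> Q"
  have "w q powr (- (s + t)) = w q powr (- t) * w q powr (- s)"
    by (simp add: powr_add[symmetric] algebra_simps)
  also have "\<dots> \<le> K powr (- t) * w q powr (- s)"
    using assms(1)[OF q] assms by (intro mult_right_mono powr_mono2') auto
  finally show "ennreal (w q powr (- (s + t))) \<le> ennreal (K powr (- t)) * ennreal (w q powr (- s))"
    by (simp add: ennreal_mult'[symmetric] ennreal_leI)
qed simp

text \<open>The root is the supremum of the \<open>s\<close> with \<open>H s \<ge> 1\<close>. This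
  set is nonempty because \<open>H\<close> is infinite at \<open>\<sigma>\<close> itself, and it is
  bounded above because \<open>H\<close> decays geometrically once it is finite.\<close>

lemma powr_sum_unique_root:
  fixes w :: "'b \<Rightarrow> real" and Q :: "'b set" and K \<sigma> :: real
  defines "H \<equiv> \<lambda>s. \<Sum>\<^sub>\<infinity>q\<in>Q. ennreal (w q powr (- s))"
  assumes w: "\<And>q. q \<in> Q \<Longrightarrow> w q \<ge> K" and K: "K > 1"
    and \<sigma>: "\<And>s. H s < \<infinity> \<longleftrightarrow> s > \<sigma>"
  shows "\<exists>!s. H s = 1"
proof -
  have decay: "H (s + t) \<le> ennreal (K powr (- t)) * H s" if "t \<ge> 0" for s t
    unfolding H_def using w K that by (rule powr_sum_decay)
  have Kt: "K powr (- t) \<le> 1" if "t \<ge> 0" for t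
    using that K powr_mono[of "- t" 0 K] by simp
  have anti: "H s' \<le> H s" if "s \<le> s'" for s s'
  proof -
    have "H s' \<le> ennreal (K powr (- (s' - s))) * H s" using decay[of "s' - s" s] that by simp
    also have "\<dots> \<le> 1 * H s" using Kt[of "s' - s"] that by (intro mult_right_mono) (auto simp: ennreal_le_1)
    finally show ?thesis by simp
  qed
  define S where "S = {s. H s \<ge> 1}"
  have "H \<sigma> = top" using \<sigma>[of \<sigma>] less_top[of "H \<sigma>"] by auto
  then have "\<sigma> \<in> S" by (simp add: S_def)
  obtain C where C: "H (\<sigma> + 1) = ennreal C" "C \<ge> 0"
    using \<sigma>[of "\<sigma> + 1"] by (cases "H (\<sigma> + 1)") auto
  \<comment> \<open>Makes \<open>K powr t = C + 1\<close>, so the decay over a distance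
    \<open>t\<close> brings \<open>H\<close> from \<open>C\<close> below 1.\<close>
  define t where "t = ln (C + 1) / ln K"
  have t: "t \<ge> 0" using C K by (simp add: t_def)
  have Kt1: "K powr t = C + 1" using C K by (simp add: powr_def t_def)
  have "H (\<sigma> + 1 + t) \<le> ennreal (K powr (- t) * C)"
    using decay[OF t, of "\<sigma> + 1"] C by (simp add: ennreal_mult'[symmetric])
  also have "K powr (- t) * C < 1" using C Kt1 by (simp add: powr_minus field_simps)
  then have "ennreal (K powr (- t) * C) < 1" using C by (simp add: ennreal_less_one_iff)
  finally have "H (\<sigma> + 1 + t) < 1" .
  then have bound: "s \<le> \<sigma> + 1 + t" if "s \<in> S" for s
    using anti[of "\<sigma> + 1 + t" s] that unfolding S_def by (metis leD le_cases mem_Collect_eq order_trans)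
  then have bdd: "bdd_above S" by (meson bdd_aboveI)
  define r where "r = Sup S"
  \<comment> \<open>Each finite partial sum is continuous and at most 1 to the right of
    \<open>r\<close>, hence at most 1 at \<open>r\<close>.\<close>
  have le1: "H r \<le> 1"
    unfolding H_def
  proof (rule infsum_ennreal_le)
    fix F assume F: "finite F" "F \<subseteq> Q"
    have "((\<lambda>s. \<Sum>q\<in>F. w q powr (- s)) \<longlongrightarrow> (\<Sum>q\<in>F. w q powr (- r))) (at_right r)"
      using F w K by (intro tendsto_sum tendsto_powr tendsto_intros) force+
    moreover have "\<forall>\<^sub>F s in at_right r. (\<Sum>q\<in>F. w q powr (- s)) \<le> 1"
      using eventually_at_right_less[of r]
    proof eventually_elim
      case (elim s)
      then have "s \<notin> S" using cSup_upper[OF _ bdd, of s] by (auto simp: r_def)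
      then have "H s < 1" by (simp add: S_def)
      moreover have "(\<Sum>q\<in>F. ennreal (w q powr (- s))) \<le> H s"
        unfolding H_def by (rule sum_le_infsum_ennreal[OF F])
      ultimately have "(\<Sum>q\<in>F. ennreal (w q powr (- s))) \<le> 1" by (meson less_imp_le order_trans)
      then have "ennreal (\<Sum>q\<in>F. w q powr (- s)) \<le> 1" by (simp add: sum_ennreal)
      then show ?case by (simp only: ennreal_le_1)
    qed
    ultimately have "(\<Sum>q\<in>F. w q powr (- r)) \<le> 1"
      by (rule tendsto_upperbound) simp
    then show "(\<Sum>q\<in>F. ennreal (w q powr (- r))) \<le> 1" by (simp add: sum_ennreal ennreal_le_1)
  qed
  then have "H r < \<infinity>" by (auto intro: le_less_trans)
  then have r: "r > \<sigma>" using \<sigma> by blast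
  have ge1: "H r \<ge> 1"
  proof (rule ccontr)
    assume "\<not> H r \<ge> 1"
    then obtain b where b: "H r = ennreal b" "0 \<le> b" "b < 1"
      by (cases "H r") (auto simp: not_le ennreal_less_one_iff)
    \<comment> \<open>If \<open>H r < 1\<close>, convexity between \<open>r\<close> and a point
      \<open>s1\<close> where \<open>H\<close> is still finite gives \<open>H s < 1\<close> for some
      \<open>s < r\<close>, contradicting the choice of \<open>r\<close> as a supremum.\<close>
    define s1 where "s1 = (\<sigma> + r) / 2"
    have s1: "s1 > \<sigma>" "s1 < r" using r by (auto simp: s1_def)
    obtain D where D: "H s1 = ennreal D" "D \<ge> 0"
      using \<sigma>[of s1] s1 by (cases "H s1") auto
    \<comment> \<open>Small enough that \<open>\<theta> * D + (1 - \<theta>) * b\<close> is at most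
      \<open>(1 + b) / 2\<close>.\<close>
    define \<theta> where "\<theta> = (1 - b) / (2 * (D + 1))"
    have \<theta>: "0 < \<theta>" "\<theta> < 1" using b D by (auto simp: \<theta>_def field_simps)
    have "\<theta> * D \<le> (1 - b) / 2" using b D by (auto simp: \<theta>_def field_simps)
    moreover have "(1 - \<theta>) * b \<le> b" using b \<theta> by (simp add: mult_left_le_one_le)
    ultimately have small: "\<theta> * D + (1 - \<theta>) * b < 1" using b by simp
    define s where "s = \<theta> * s1 + (1 - \<theta>) * r"
    have "\<theta> * s1 < \<theta> * r" using \<theta> s1 by simp
    then have "s < r" by (simp add: s_def algebra_simps)
    then obtain s' where s': "s' \<in> S" "s < s'"
      unfolding r_def using \<open>\<sigma> \<in> S\<close> bdd by (subst (asm) less_cSup_iff) auto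
    have "H s \<le> (\<Sum>\<^sub>\<infinity>q\<in>Q. ennreal \<theta> * ennreal (w q powr (- s1)) + ennreal (1 - \<theta>) * ennreal (w q powr (- r)))"
      unfolding H_def
    proof (rule infsum_ennreal_mono)
      fix q assume "q \<in> Q"
      then have "w q > 0" using w K by fastforce
      then show "ennreal (w q powr (- s)) \<le> ennreal \<theta> * ennreal (w q powr (- s1)) + ennreal (1 - \<theta>) * ennreal (w q powr (- r))"
        using powr_neg_convex[of "w q" \<theta> s1 r] \<theta>
        by (simp add: s_def ennreal_mult'[symmetric] ennreal_plus[symmetric] ennreal_leI del: ennreal_plus)
    qed simp
    also have "\<dots> = ennreal \<theta> * H s1 + ennreal (1 - \<theta>) * H r"
      unfolding H_def infsum_ennreal_cmult[symmetric]
      by (rule infsum_add) (rule ennreal_summable_on)+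
    also have "\<dots> = ennreal (\<theta> * D + (1 - \<theta>) * b)"
      using b D \<theta> by (simp add: ennreal_mult' ennreal_plus)
    also have "\<dots> < 1" using small b D \<theta> by (subst ennreal_less_one_iff) auto
    finally show False using s' anti[of s s'] by (auto simp: S_def)
  qed
  show ?thesis
  proof (rule ex1I)
    show "H r = 1" using le1 ge1 by (rule antisym)
    have lt: "H s' < 1" if "s < s'" "H s = 1" for s s'
    proof -
      have "H s' \<le> ennreal (K powr (- (s' - s)))" using decay[of "s' - s" s] that by simp
      also have "\<dots> < 1" using powr_less_mono[of "- (s' - s)" 0 K] K that(1) by (simp add: ennreal_less_one_iff)
      finally show ?thesis .
    qed
    fix s assume "H s = 1"
    with \<open>H r = 1\<close> show "s = r" using lt[of s r] lt[of r s] by (cases s r rule: linorder_cases) auto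
  qed
qed

subsection \<open>Words\<close>

text \<open>A nonconstant word ends in its last maximal run preceded by a different letter, and
  these together form a word of \<open>J_words\<close>.\<close>

lemma word_decomp:
  "(\<exists>i p. W = replicate p i) \<or> (\<exists>W' J. W = W' @ J \<and> J \<in> J_words)"
proof (induction W rule: rev_induct)
  case Nil
  then show ?case by (metis replicate_0)
next
  case (snoc x W)
  from snoc.IH show ?case
  proof (elim disjE exE conjE)
    fix i p assume W: "W = replicate p i"
    show ?thesis
    proof (cases "p = 0 \<or> x = i")
      case True
      then have "W @ [x] = replicate (Suc p) x" using W by (auto simp: replicate_append_same)
      then show ?thesis by blast
    next
      case False
      then have "W @ [x] = replicate (p - 1) i @ (i # replicate 1 x)" using W
        by (cases p) (auto simp: replicate_append_same[symmetric])
      moreover have "i # replicate 1 x \<in> J_words" using False unfolding J_words_def by blast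
      ultimately show ?thesis by blast
    qed
  next
    fix W' J assume W: "W = W' @ J" and "J \<in> J_words"
    then obtain i j p where J: "J = i # replicate p j" "i \<noteq> j" "p \<ge> 1" by (auto simp: J_words_def)
    show ?thesis
    proof (cases "x = j")
      case True
      then have "W @ [x] = W' @ (i # replicate (Suc p) j)"
        using W J by (simp add: replicate_append_same)
      moreover have "i # replicate (Suc p) j \<in> J_words" using J(2) unfolding J_words_def by fastforce
      ultimately show ?thesis by blast
    next
      case False
      then have "W @ [x] = (W' @ i # replicate (p - 1) j) @ (j # replicate 1 x)"
        using W J by (cases p) (auto simp: replicate_append_same[symmetric])
      moreover have "j # replicate 1 x \<in> J_words" using False unfolding J_words_def by blast
      ultimately show ?thesis by blast
    qed
  qed
qed

text \<open>Read from the right, the suffix stops at the first letter that differs from the last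
  one, so the whole word determines it.\<close>

lemma J_words_suffix_code:
  assumes "J \<in> J_words" "J' \<in> J_words" "W @ J = W' @ J'"
  shows "J = J'"
proof -
  obtain i j p where J: "J = i # replicate p j" "i \<noteq> j" "p \<ge> 1" using assms by (auto simp: J_words_def)
  obtain i' j' p' where J': "J' = i' # replicate p' j'" "i' \<noteq> j'" "p' \<ge> 1" using assms by (auto simp: J_words_def)
  have "last (W @ J) = j" "last (W' @ J') = j'" using J J' by auto
  then have j: "j' = j" using assms(3) by simp
  have "rev (W @ J) = replicate p j @ i # rev W" "rev (W' @ J') = replicate p' j @ i' # rev W'"
    using J J' j by auto
  then have eq: "replicate p j @ i # rev W = replicate p' j @ i' # rev W'" using assms(3) by metis
  have tw: "takeWhile (\<lambda>x. x = j) (replicate q j @ k # U) = replicate q j" if "k \<noteq> j" for q k and U :: "'a list"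
    using that by (induction q) auto
  have "p = p'" using eq tw[of i p "rev W"] tw[of i' p' "rev W'"] J(2) J'(2) j
    by (metis length_replicate)
  then show ?thesis using eq J J' j by simp
qed

text \<open>By induction on the level. The critical case is a kept word against a prolonged one: by
  the code property one level below, the kept word equals the tail of the other, but the first has
  norm above \<open>k\<close> and the second does not.\<close>

lemma Q_seq_suffix_code:
  assumes "q \<in> Q_seq A k l" "q' \<in> Q_seq A k l" "W @ q = W' @ q'"
  shows "q = q'"
  using assms
proof (induction l arbitrary: q q' W W')
  case 0
  then show ?case using J_words_suffix_code by auto
next
  case (Suc l)
  have mixed: False if r: "r \<in> Q_seq A k l" "max_norm (A r) > k"
    and r': "r' \<in> word_prod J_words {J \<in> Q_seq A k l. max_norm (A J) \<le> k}"
    and eq: "V @ r = V' @ r'" for r r' V V'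
  proof -
    obtain J s where s: "r' = J @ s" "s \<in> Q_seq A k l" "max_norm (A s) \<le> k"
      using r' by (auto simp: word_prod_def)
    have "r = s" using Suc.IH[OF r(1) s(2), of V "V' @ J"] eq s(1) by simp
    then show False using s(3) r(2) by simp
  qed
  have long: ?case if a: "q \<in> word_prod J_words {J \<in> Q_seq A k l. max_norm (A J) \<le> k}"
    and b: "q' \<in> word_prod J_words {J \<in> Q_seq A k l. max_norm (A J) \<le> k}"
  proof -
    obtain J s where s: "q = J @ s" "s \<in> Q_seq A k l" "J \<in> J_words"
      using a by (auto simp: word_prod_def)
    obtain J' s' where s': "q' = J' @ s'" "s' \<in> Q_seq A k l" "J' \<in> J_words"
      using b by (auto simp: word_prod_def)
    have "s = s'" using Suc.IH[OF s(2) s'(2), of "W @ J" "W' @ J'"] Suc.prems(3) s(1) s'(1) by simp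
    then have "J = J'" using J_words_suffix_code[OF s(3) s'(3), of W W'] Suc.prems(3) s(1) s'(1) by simp
    then show ?thesis using s s' \<open>s = s'\<close> by simp
  qed
  from Suc.prems(1,2) show ?case
    using Suc.IH[of q q' W W'] Suc.prems(3) mixed[of q q' W W'] mixed[of q' q W' W] long by auto
qed

text \<open>A word whose norm is still at most \<open>k\<close> has been prolonged at every level.
  If only finitely many words have such norms, none survives at high levels and the recursion
  stabilises.\<close>

lemma length_short_Q_seq:
  assumes "q \<in> Q_seq A k l" "max_norm (A q) \<le> k"
  shows "length q \<ge> l"
  using assms
proof (induction l arbitrary: q)
  case (Suc l)
  then obtain J s where "q = J @ s" "s \<in> Q_seq A k l" "J \<in> J_words" "max_norm (A s) \<le> k"
    by (auto simp: word_prod_def)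
  then show ?case using Suc.IH[of s] by (auto simp: J_words_def)
qed simp

lemma J_words_subset_JI: "J \<in> J_words \<Longrightarrow> J @ W \<in> word_prod J_words UNIV"
  unfolding word_prod_def by blast

lemma Q_seq_subset_JI: "q \<in> Q_seq A k l \<Longrightarrow> q \<in> word_prod J_words UNIV"
proof (induction l arbitrary: q)
  case 0
  then show ?case using J_words_subset_JI[of q "[]"] by simp
next
  case (Suc l)
  then show ?case by (auto simp: word_prod_def)
qed

text \<open>A prolonged word has a tail of norm at most \<open>k\<close> from the level below. When
  such tails are finitely many, sums over \<open>Q\<close> become comparable with sums over
  \<open>J_words\<close>.\<close>

lemma Q_seq_subset:
  "q \<in> Q_seq A k l \<Longrightarrow>
    q \<in> word_prod J_words (insert [] {r. r \<in> word_prod J_words UNIV \<and> max_norm (A r) \<le> k})"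
proof (induction l arbitrary: q)
  case 0
  then show ?case unfolding word_prod_def by force
next
  case (Suc l)
  then show ?case using Q_seq_subset_JI[of _ A k l] by (auto simp: word_prod_def) blast
qed

lemma J_words_in_Q_seq: "J \<in> J_words \<Longrightarrow> max_norm (A J) > k \<Longrightarrow> J \<in> Q_seq A k l"
  by (induction l) auto

text \<open>If the suffix \<open>q\<close> found so far is to be prolonged, the rest of the word
  either ends in a \<open>J_words\<close> suffix, which is moved to \<open>q\<close>, or is
  constant, and then \<open>q\<close> itself is the tail \<open>U\<close>.\<close>

lemma Q_seq_cover:
  "(\<exists>i p U. W = replicate p i @ U \<and> U \<in> insert [] {r. r \<in> word_prod J_words UNIV \<and> max_norm (A r) \<le> k})
   \<or> (\<exists>W' q. W = W' @ q \<and> q \<in> Q_seq A k l)"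
proof (induction l)
  case 0
  have "\<exists>i' p' U. replicate p i = replicate p' i' @ U \<and>
      U \<in> insert [] {r. r \<in> word_prod J_words UNIV \<and> max_norm (A r) \<le> k}" for p and i :: 'a
    by (intro exI[of _ i] exI[of _ p] exI[of _ "[]"]) simp
  then show ?case using word_decomp[of W] by auto
next
  case (Suc l)
  then show ?case
  proof
    assume "\<exists>W' q. W = W' @ q \<and> q \<in> Q_seq A k l"
    then obtain W' q where W: "W = W' @ q" "q \<in> Q_seq A k l" by blast
    show ?thesis
    proof (cases "max_norm (A q) \<le> k")
      case True
      from word_decomp[of W'] show ?thesis
      proof
        assume "\<exists>i p. W' = replicate p i"
        then show ?thesis using W True Q_seq_subset_JI[OF W(2)] by auto
      next
        assume "\<exists>V J. W' = V @ J \<and> J \<in> J_words"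
        then obtain V J where V: "W' = V @ J" "J \<in> J_words" by blast
        then have "J @ q \<in> Q_seq A k (Suc l)" using W True by (auto simp: word_prod_def)
        moreover have "W = V @ (J @ q)" using W V by simp
        ultimately show ?thesis by blast
      qed
    next
      case False
      then have "q \<in> Q_seq A k (Suc l)" using W by auto
      then show ?thesis using W by blast
    qed
  qed blast
qed

lemma Q_words_eq_Q_seq:
  assumes fin: "finite {I. max_norm (A I) \<le> k}"
  obtains l where "Q_words A k = Q_seq A k l" "\<And>q. q \<in> Q_words A k \<Longrightarrow> max_norm (A q) > k"
proof -
  \<comment> \<open>One more than the length of any word of norm at most \<open>k\<close>, so
    \<open>length_short_Q_seq\<close> excludes such words from this level on.\<close>
  define l where "l = Suc (Max (insert 0 (length ` {I. max_norm (A I) \<le> k})))"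
  have big: "max_norm (A q) > k" if "q \<in> Q_seq A k l'" "l' \<ge> l" for q l'
  proof (rule ccontr)
    assume "\<not> ?thesis"
    then have q: "max_norm (A q) \<le> k" by simp
    then have "length q \<le> Max (insert 0 (length ` {I. max_norm (A I) \<le> k}))"
      by (intro Max_ge) (use fin in auto)
    then show False using length_short_Q_seq[OF that(1) q] that(2) unfolding l_def by simp
  qed
  have step: "Q_seq A k (Suc l') = Q_seq A k l'" if "l' \<ge> l" for l'
    using big[OF _ that] by (auto simp: word_prod_def not_le[symmetric])
  have const: "Q_seq A k l' = Q_seq A k l" if "l' \<ge> l" for l'
    using that by (induction l' rule: dec_induct) (use step in auto)
  then have ev: "\<forall>\<^sub>F l' in sequentially. Q_seq A k l' = Q_seq A k l"
    unfolding eventually_sequentially by blast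
  have "Q_words A k = Q_seq A k l"
    unfolding Q_words_def
  proof (rule the_equality, rule ev)
    fix Q assume "\<forall>\<^sub>F l' in sequentially. Q_seq A k l' = Q"
    with ev have "\<forall>\<^sub>F l' in sequentially. Q = Q_seq A k l" by eventually_elim auto
    then show "Q = Q_seq A k l" by simp
  qed
  then show ?thesis using that big[of _ l] by simp
qed

subsection \<open>Gaskets with finite fibres\<close>

lemma finite_max_norm_entries: "finite {norm (M $ i $ j) | i j. True}"
  for M :: "'a::real_normed_field ^ 'n ^ 'n"
proof -
  have "{norm (M $ i $ j) | i j. True} = (\<lambda>(i, j). norm (M $ i $ j)) ` UNIV" by auto
  then show ?thesis by simp
qed

lemma norm_entry_le_max_norm: "norm (M $ i $ j) \<le> max_norm M"
  unfolding max_norm_def by (rule Max_ge[OF finite_max_norm_entries]) auto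

lemma max_norm_le: "(\<And>i j. norm (M $ i $ j) \<le> r) \<Longrightarrow> max_norm M \<le> r"
  unfolding max_norm_def by (subst Max_le_iff[OF finite_max_norm_entries]) auto

lemma max_norm_nonneg: "max_norm M \<ge> 0"
  using order_trans[OF norm_ge_zero norm_entry_le_max_norm] .

lemma max_norm_mat_1: "max_norm (mat 1 :: 'a::real_normed_field ^ 'n ^ 'n) = 1"
proof (rule antisym)
  show "max_norm (mat 1 :: 'a ^ 'n ^ 'n) \<le> 1" by (rule max_norm_le) (auto simp: mat_def)
  show "1 \<le> max_norm (mat 1 :: 'a ^ 'n ^ 'n)"
    using norm_entry_le_max_norm[of "mat 1 :: 'a ^ 'n ^ 'n" i i for i] by (simp add: mat_def)
qed

lemma max_norm_mult_le:
  fixes M :: "'a::real_normed_field ^ 'n ^ 'n"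
  shows "max_norm (M ** M') \<le> real CARD('n) * max_norm M * max_norm M'"
proof (rule max_norm_le)
  fix i j
  have "norm ((M ** M') $ i $ j) \<le> (\<Sum>k\<in>UNIV. norm (M $ i $ k * M' $ k $ j))"
    by (simp add: matrix_matrix_mult_def norm_sum)
  also have "\<dots> \<le> (\<Sum>k\<in>(UNIV::'n set). max_norm M * max_norm M')"
    by (intro sum_mono) (simp add: norm_mult mult_mono norm_entry_le_max_norm max_norm_nonneg)
  finally show "norm ((M ** M') $ i $ j) \<le> real CARD('n) * max_norm M * max_norm M'" by simp
qed

lemma max_norm_le_norm:
  fixes M :: "'a::{real_normed_field,euclidean_space} ^ 'n ^ 'n"
  shows "max_norm M \<le> norm M"
  by (rule max_norm_le, rule order_trans[OF Finite_Cartesian_Product.norm_nth_le Finite_Cartesian_Product.norm_nth_le])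

lemma norm_le_max_norm:
  fixes M :: "'a::{real_normed_field,euclidean_space} ^ 'n ^ 'n"
  shows "norm M \<le> real CARD('n) ^ 2 * max_norm M"
proof -
  have "norm (M $ i) \<le> real CARD('n) * max_norm M" for i
  proof -
    have "norm (M $ i) \<le> (\<Sum>j\<in>UNIV. norm (M $ i $ j))"
      unfolding norm_vec_def by (rule L2_set_le_sum) simp
    also have "\<dots> \<le> (\<Sum>j\<in>(UNIV::'n set). max_norm M)" by (intro sum_mono norm_entry_le_max_norm)
    finally show ?thesis by simp
  qed
  then have "(\<Sum>i\<in>UNIV. norm (M $ i)) \<le> (\<Sum>i\<in>(UNIV::'n set). real CARD('n) * max_norm M)"
    by (intro sum_mono)
  moreover have "norm M \<le> (\<Sum>i\<in>UNIV. norm (M $ i))"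
    unfolding norm_vec_def[of M] by (rule L2_set_le_sum) simp
  ultimately show ?thesis by (simp add: power2_eq_square)
qed

text \<open>Applied to the powers of one matrix, this plays the role of the Cayley-Hamilton
  theorem.\<close>

lemma sequence_relation:
  fixes y :: "nat \<Rightarrow> 'v::euclidean_space"
  shows "\<exists>D a i0. i0 \<le> D \<and> a i0 \<noteq> 0 \<and> (\<Sum>i\<le>D. a i *\<^sub>R y i) = 0"
proof -
  define D where "D = DIM('v)"
  show ?thesis
  proof (cases "inj_on y {..D}")
    case False
    then obtain i j where ij: "i \<le> D" "j \<le> D" "i \<noteq> j" "y i = y j" by (auto simp: inj_on_def)
    define a where "a k = (if k = i then 1 else if k = j then - 1 else 0 :: real)" for k
    have "(\<Sum>k\<le>D. a k *\<^sub>R y k) = (\<Sum>k\<in>{i, j}. a k *\<^sub>R y k)"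
      by (rule sum.mono_neutral_right) (use ij in \<open>auto simp: a_def\<close>)
    also have "\<dots> = 0" using ij by (simp add: a_def)
    finally show ?thesis using ij by (intro exI[of _ D] exI[of _ a] exI[of _ i]) (simp add: a_def)
  next
    case True
    then have "card (y ` {..D}) > DIM('v)" by (simp add: card_image D_def)
    then have "dependent (y ` {..D})" by (intro dependent_biggerset)
    then obtain u v where u: "v \<in> y ` {..D}" "u v \<noteq> 0" "(\<Sum>v\<in>y ` {..D}. u v *\<^sub>R v) = 0"
      using dependent_finite[of "y ` {..D}"] by auto
    then obtain i0 where "i0 \<le> D" "v = y i0" by auto
    moreover have "(\<Sum>i\<le>D. u (y i) *\<^sub>R y i) = 0"
      using u(3) sum.reindex[OF True, of "\<lambda>v. u v *\<^sub>R v"] by simp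
    ultimately show ?thesis using u(2)
      by (intro exI[of _ D] exI[of _ "\<lambda>i. u (y i)"] exI[of _ i0]) simp
  qed
qed

lemma linear_matrix_mult: "linear (\<lambda>Y :: 'a::{real_normed_field,euclidean_space} ^ 'n ^ 'n. X ** Y)"
  by (rule linearI)
    (simp_all add: matrix_matrix_mult_def vec_eq_iff distrib_left sum.distrib scaleR_sum_right)

text \<open>The sort of \<open>'a\<close> covers \<open>real\<close> and \<open>complex\<close>
  together. The gasket condition counts matrices; \<open>finite_fibres\<close> turns it into
  finiteness of the set of words of bounded norm (\<open>finite_N_le\<close>).\<close>

locale finite_fibre_gasket =
  fixes A :: "'m::finite list \<Rightarrow> 'a::{real_normed_field,euclidean_space} ^ 'n ^ 'n"
  assumes letters: "CARD('m) \<ge> 2"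
    and fast: "fast_gasket A"
    and finite_fibres: "\<And>M. finite {I. A I = M}"
begin

abbreviation N :: "'m list \<Rightarrow> real" where "N I \<equiv> max_norm (A I)"
abbreviation c :: real where "c \<equiv> coefficient A"
abbreviation JI :: "'m list set" where "JI \<equiv> word_prod J_words UNIV"

lemma A_append: "A (I @ J) = A I ** A J" and A_Nil: "A [] = mat 1"
  using fast by (auto simp: fast_gasket_def gasket_def word_hom_def)

lemma N_Nil: "N [] = 1"
  by (simp add: A_Nil max_norm_mat_1)

lemma n_ge_1: "real CARD('n) \<ge> 1"
  using zero_less_card_finite[where 'a = 'n] by linarith

lemma N_append_le: "N (I @ J) \<le> real CARD('n) * N I * N J"
  by (simp add: A_append max_norm_mult_le)

lemma finite_N_le: "finite {I. N I \<le> r}"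
proof -
  have "finite (max_cball (max r 1) \<inter> range A)"
    using fast by (simp add: fast_gasket_def gasket_def)
  then have "finite (\<Union>M\<in>max_cball (max r 1) \<inter> range A. {I. A I = M})"
    using finite_fibres by blast
  then show ?thesis
    by (rule rev_finite_subset) (auto simp: max_cball_def)
qed

lemma infinite_words: "infinite (UNIV :: 'm list set)"
  by (metis infinite_UNIV_listI)

text \<open>A zero matrix would make all extensions of its word zero, giving infinitely many words
  of norm at most 1.\<close>

lemma N_pos: "N I > 0"
proof (rule ccontr)
  assume "\<not> N I > 0"
  then have "N I = 0" using max_norm_nonneg[of "A I"] by simp
  then have "N (I @ L) \<le> 1" for L using N_append_le[of I L] by simp
  then have "range (\<lambda>L. I @ L) \<subseteq> {W. N W \<le> 1}" by auto
  then have "finite (range (\<lambda>L. I @ L))" using finite_N_le finite_subset by blast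
  then show False using infinite_words by (subst (asm) finite_image_iff) (auto simp: inj_on_def)
qed

lemma exists_J: "\<exists>J :: 'm list. J \<in> J_words"
proof -
  obtain i j :: 'm where "i \<noteq> j"
    using letters card_le_Suc0_iff_eq[of "UNIV :: 'm set"] by auto
  then have "i # replicate 1 j \<in> J_words" unfolding J_words_def by blast
  then show ?thesis by blast
qed

lemma coefficient_pos: "c > 0" and coefficient_le_1: "c \<le> 1"
  and N_append_ge: "J \<in> JI \<Longrightarrow> N (I @ J) \<ge> c * N I * N J"
proof -
  define R where "R = {N (I @ J) / (N I * N J) | I J. J \<in> JI}"
  obtain c0 where c0: "c0 > 0" "\<And>I J. J \<in> JI \<Longrightarrow> N (I @ J) \<ge> c0 * N I * N J"
    using fast by (auto simp: fast_gasket_def)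
  have lb: "c0 \<le> x" if "x \<in> R" for x
    using that c0(2) N_pos by (auto simp: R_def pos_le_divide_eq mult.assoc)
  obtain J0 :: "'m list" where J0: "J0 \<in> J_words" using exists_J by blast
  then have JJ: "J0 \<in> JI" using J_words_subset_JI[of J0 "[]"] by simp
  \<comment> \<open>With an empty left factor the ratio is 1. This shows that the infimum is over a
    nonempty set and that it is at most 1.\<close>
  have "N ([] @ J0) / (N [] * N J0) \<in> R" unfolding R_def using JJ by blast
  then have one: "1 \<in> R" using N_pos[of J0] by (simp add: N_Nil)
  have cR: "c = Inf R" by (simp add: coefficient_def R_def)
  have "c0 \<le> Inf R" by (rule cInf_greatest) (use one lb in auto)
  then show "c > 0" using c0(1) cR by simp
  have bdd: "bdd_below R" using lb by (meson bdd_below.I)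
  show "c \<le> 1" unfolding cR by (rule cInf_lower[OF one bdd])
  show "N (I @ J) \<ge> c * N I * N J" if "J \<in> JI"
  proof -
    have "N (I @ J) / (N I * N J) \<in> R" unfolding R_def using that by blast
    then have "c \<le> N (I @ J) / (N I * N J)" unfolding cR by (rule cInf_lower[OF _ bdd])
    then show ?thesis using N_pos[of I] N_pos[of J] by (simp add: field_simps)
  qed
qed

text \<open>The matrix of \<open>i # replicate (Suc p) j\<close> is a fixed matrix times the
  \<open>p\<close>-th power of \<open>A [j]\<close>, so a linear relation among these powers is a
  recurrence along the run. The norms tend to infinity because the words are distinct.\<close>

lemma abscissa_run:
  "\<exists>\<sigma>\<ge>0. \<forall>s. summable (\<lambda>p. N (i # replicate (Suc p) j) powr (- s)) \<longleftrightarrow> s > \<sigma>"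
proof -
  define x where "x p = A (i # replicate (Suc p) j)" for p
  have shift: "x (p + l) = x p ** A (replicate l j)" for p l
  proof -
    have "i # replicate (Suc (p + l)) j = (i # replicate (Suc p) j) @ replicate l j"
      by (simp add: replicate_add)
    then show ?thesis unfolding x_def by (metis A_append)
  qed
  have lim: "filterlim (\<lambda>p. N (i # replicate (Suc p) j)) at_top sequentially"
    unfolding filterlim_at_top
  proof
    fix Z
    have "inj (\<lambda>p. i # replicate (Suc p) j)" by (auto simp: inj_on_def dest: arg_cong[of _ _ length])
    then have "finite ((\<lambda>p. i # replicate (Suc p) j) -` {I. N I \<le> Z})"
      by (rule finite_vimageI[OF finite_N_le])
    then have "\<forall>\<^sub>F p in sequentially. p \<notin> (\<lambda>p. i # replicate (Suc p) j) -` {I. N I \<le> Z}"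
      by (simp add: eventually_cofinite cofinite_eq_sequentially[symmetric] vimage_def)
    then show "\<forall>\<^sub>F p in sequentially. Z \<le> N (i # replicate (Suc p) j)"
      by eventually_elim auto
  qed
  have le: "N (i # replicate (Suc p) j) \<le> norm (x p)" for p
    unfolding x_def by (rule max_norm_le_norm)
  have ge: "norm (x p) \<le> (real CARD('n))\<^sup>2 * N (i # replicate (Suc p) j)" for p
    unfolding x_def by (rule norm_le_max_norm)
  obtain D a i0 where a: "i0 \<le> D" "a i0 \<noteq> (0::real)" "(\<Sum>l\<le>D. a l *\<^sub>R A (replicate l j)) = 0"
    using sequence_relation[of "\<lambda>l. A (replicate l j)"] by blast
  have "\<exists>\<sigma>\<ge>0. \<forall>s. summable (\<lambda>p. norm (x p) powr (- s)) \<longleftrightarrow> s > \<sigma>"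
  proof (rule abscissa_of_recurrence[where a = a, OF a(1,2)])
    fix p
    have "(\<Sum>l\<le>D. a l *\<^sub>R x (p + l)) = (\<Sum>l\<le>D. x p ** (a l *\<^sub>R A (replicate l j)))"
      unfolding shift by (simp add: linear_cmul[OF linear_matrix_mult])
    also have "\<dots> = x p ** (\<Sum>l\<le>D. a l *\<^sub>R A (replicate l j))"
      by (simp add: linear_sum[OF linear_matrix_mult])
    also have "\<dots> = 0" unfolding a(3) by (rule linear_0[OF linear_matrix_mult])
    finally show "(\<Sum>l\<le>D. a l *\<^sub>R x (p + l)) = 0" .
    have "norm (x (Suc p)) \<le> (real CARD('n))\<^sup>2 * max_norm (x p ** A [j])"
      using norm_le_max_norm[of "x (Suc p)"] shift[of p 1] by simp
    also have "\<dots> \<le> (real CARD('n))\<^sup>2 * (real CARD('n) * max_norm (x p) * N [j])"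
      by (intro mult_left_mono max_norm_mult_le) simp
    also have "\<dots> \<le> (real CARD('n))\<^sup>2 * (real CARD('n) * norm (x p) * N [j])"
      by (intro mult_left_mono mult_right_mono max_norm_le_norm max_norm_nonneg) auto
    finally show "norm (x (Suc p)) \<le> ((real CARD('n))\<^sup>2 * real CARD('n) * N [j]) * norm (x p)" by (simp add: mult_ac)
  next
    show "filterlim (\<lambda>p. norm (x p)) at_top sequentially"
      by (rule filterlim_at_top_mono[OF lim]) (use le in auto)
  qed
  then obtain \<sigma> where \<sigma>: "\<sigma> \<ge> 0" "\<And>s. summable (\<lambda>p. norm (x p) powr (- s)) \<longleftrightarrow> s > \<sigma>" by blast
  have "summable (\<lambda>p. N (i # replicate (Suc p) j) powr (- s)) \<longleftrightarrow> s > \<sigma>" for s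
  proof (cases "s > 0")
    \<comment> \<open>The Euclidean and the max norm agree up to the factor \<open>n ^ 2\<close>, so
      for \<open>s > 0\<close> the terms agree up to a constant factor.\<close>
    case True
    have "summable (\<lambda>p. N (i # replicate (Suc p) j) powr (- s)) \<longleftrightarrow> summable (\<lambda>p. norm (x p) powr (- s))"
    proof
      assume sm: "summable (\<lambda>p. N (i # replicate (Suc p) j) powr (- s))"
      show "summable (\<lambda>p. norm (x p) powr (- s))"
        by (rule summable_comparison_test'[OF sm, of 0]) (use le N_pos True in \<open>simp add: powr_mono2'\<close>)
    next
      assume sm: "summable (\<lambda>p. norm (x p) powr (- s))"
      show "summable (\<lambda>p. N (i # replicate (Suc p) j) powr (- s))"
      proof (rule summable_comparison_test'[OF summable_mult[OF sm, of "(real CARD('n))\<^sup>2 powr s"], of 0])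
        fix p :: nat
        have "norm (x p) > 0" using le[of p] N_pos[of "i # replicate (Suc p) j"] by linarith
        then have "((real CARD('n))\<^sup>2 * N (i # replicate (Suc p) j)) powr (- s) \<le> norm (x p) powr (- s)"
          using ge True by (intro powr_mono2') auto
        moreover have "((real CARD('n))\<^sup>2 * N (i # replicate (Suc p) j)) powr (- s)
            = (real CARD('n))\<^sup>2 powr (- s) * N (i # replicate (Suc p) j) powr (- s)"
          by (simp add: powr_mult max_norm_nonneg)
        moreover have "(real CARD('n))\<^sup>2 powr s * (real CARD('n))\<^sup>2 powr (- s) = 1"
          using n_ge_1 by (simp add: powr_add[symmetric])
        ultimately have "(real CARD('n))\<^sup>2 powr s * (real CARD('n))\<^sup>2 powr (- s) = 1"
          and "(real CARD('n))\<^sup>2 powr s * ((real CARD('n))\<^sup>2 powr (- s) * N (i # replicate (Suc p) j) powr (- s))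
            \<le> (real CARD('n))\<^sup>2 powr s * norm (x p) powr (- s)"
          by (simp_all add: mult_left_mono)
        then have "N (i # replicate (Suc p) j) powr (- s) \<le> (real CARD('n))\<^sup>2 powr s * norm (x p) powr (- s)"
          by (simp only: mult.assoc[symmetric] mult_1_left)
        then show "norm (N (i # replicate (Suc p) j) powr (- s)) \<le> (real CARD('n))\<^sup>2 powr s * norm (x p) powr (- s)"
          by simp
      qed
    qed
    then show ?thesis using \<sigma>(2) by simp
  next
    case False
    then show ?thesis using not_summable_powr_nonpos[OF lim, of s] \<sigma>(1) by auto
  qed
  then show ?thesis using \<sigma>(1) by blast
qed

subsection \<open>The zeta function and its exponent\<close>

definition Z :: "'m list set \<Rightarrow> real \<Rightarrow> ennreal" where
  "Z S s = (\<Sum>\<^sub>\<infinity>J\<in>S. ennreal (N J powr (- s)))"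

lemma Z_mono: "S \<subseteq> T \<Longrightarrow> Z S s \<le> Z T s"
  unfolding Z_def by (rule infsum_ennreal_mono) auto

lemma Z_finite: "finite S \<Longrightarrow> Z S s < \<infinity>"
  by (simp add: Z_def)

lemma Z_Un_le: "Z (S \<union> T) s \<le> Z S s + Z T s"
  unfolding Z_def by (rule infsum_ennreal_Un_le)

lemma Z_Un_finite:
  assumes "Z S s < \<infinity>" "Z T s < \<infinity>"
  shows "Z (S \<union> T) s < \<infinity>"
  by (rule le_less_trans[OF Z_Un_le]) (use assms in \<open>simp add: ennreal_add_less_top\<close>)

lemma Z_UN_finite:
  assumes "finite I" "\<And>i. i \<in> I \<Longrightarrow> Z (S i) s < \<infinity>"
  shows "Z (\<Union>i\<in>I. S i) s < \<infinity>"
  using assms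
proof (induction I rule: finite_induct)
  case empty
  show ?case using Z_finite[of "{}" s] by simp
next
  case (insert i I)
  then have "Z (S i \<union> (\<Union>i\<in>I. S i)) s < \<infinity>" by (intro Z_Un_finite) blast+
  then show ?case by simp
qed

lemma Z_UN_le: "finite I \<Longrightarrow> Z (\<Union>i\<in>I. S i) s \<le> (\<Sum>i\<in>I. Z (S i) s)"
  unfolding Z_def by (rule infsum_ennreal_UN_le)

lemma Z_image_le:
  assumes "\<And>V. V \<in> S \<Longrightarrow> N (h V) powr (- s) \<le> b * N V powr (- s)" "b \<ge> 0"
  shows "Z (h ` S) s \<le> ennreal b * Z S s"
proof -
  have "Z (h ` S) s \<le> (\<Sum>\<^sub>\<infinity>V\<in>S. ennreal (N (h V) powr (- s)))"
    unfolding Z_def by (rule infsum_ennreal_image_le)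
  also have "\<dots> \<le> (\<Sum>\<^sub>\<infinity>V\<in>S. ennreal b * ennreal (N V powr (- s)))"
    by (rule infsum_ennreal_mono) (use assms in \<open>auto simp: ennreal_mult'[symmetric] ennreal_leI\<close>)
  finally show ?thesis by (simp add: infsum_ennreal_cmult Z_def)
qed

text \<open>\<open>J_words\<close> is a finite union of runs, one for each pair of distinct letters.
  The largest abscissa counts, and divergence at it is inherited from a run attaining it.\<close>

lemma abscissa_J_words: "\<exists>\<sigma>\<ge>0. \<forall>s. Z J_words s < \<infinity> \<longleftrightarrow> s > \<sigma>"
proof -
  define P where "P = {(i, j) | i j :: 'm. i \<noteq> j}"
  define run where "run ij = range (\<lambda>p. fst ij # replicate (Suc p) (snd ij))" for ij :: "'m \<times> 'm"
  have P: "finite P" "P \<noteq> {}"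
    using exists_J by (auto simp: P_def J_words_def)
  have J: "J_words = (\<Union>ij\<in>P. run ij)"
  proof (intro equalityI subsetI)
    fix W :: "'m list" assume "W \<in> J_words"
    then obtain i j p where W: "W = i # replicate p j" "i \<noteq> j" "p \<ge> 1" by (auto simp: J_words_def)
    then have "W = fst (i, j) # replicate (Suc (p - 1)) (snd (i, j))" by simp
    then have "W \<in> run (i, j)" unfolding run_def by blast
    then show "W \<in> (\<Union>ij\<in>P. run ij)" using W(2) by (auto simp: P_def)
  next
    fix W assume "W \<in> (\<Union>ij\<in>P. run ij)"
    then obtain i j p where "W = i # replicate (Suc p) j" "i \<noteq> j" by (auto simp: P_def run_def)
    then show "W \<in> J_words" unfolding J_words_def by fastforce
  qed
  have "\<forall>ij. \<exists>\<sigma>\<ge>0. \<forall>s. Z (run ij) s < \<infinity> \<longleftrightarrow> s > \<sigma>"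
  proof
    fix ij :: "'m \<times> 'm"
    have inj: "inj (\<lambda>p. fst ij # replicate (Suc p) (snd ij))"
      by (auto simp: inj_on_def dest: arg_cong[of _ _ length])
    have "Z (run ij) s = (\<Sum>\<^sub>\<infinity>p. ennreal (N (fst ij # replicate (Suc p) (snd ij)) powr (- s)))" for s
      unfolding Z_def run_def by (subst infsum_reindex[OF inj]) (simp add: o_def)
    then show "\<exists>\<sigma>\<ge>0. \<forall>s. Z (run ij) s < \<infinity> \<longleftrightarrow> s > \<sigma>"
      using abscissa_run[of "fst ij" "snd ij"] infsum_ennreal_less_top_iff_summable by simp
  qed
  then obtain \<sigma> where \<sigma>: "\<And>ij. \<sigma> ij \<ge> 0" "\<And>ij s. Z (run ij) s < \<infinity> \<longleftrightarrow> s > \<sigma> ij"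
    using choice[of "\<lambda>ij \<sigma>. \<sigma> \<ge> 0 \<and> (\<forall>s. Z (run ij) s < \<infinity> \<longleftrightarrow> s > \<sigma>)"] by blast
  define \<tau> where "\<tau> = Max (\<sigma> ` P)"
  have "\<tau> \<in> \<sigma> ` P" unfolding \<tau>_def by (rule Max_in) (use P in auto)
  then obtain ij where ij: "ij \<in> P" "\<tau> = \<sigma> ij" by blast
  have max: "\<sigma> ij \<le> \<tau>" if "ij \<in> P" for ij unfolding \<tau>_def by (rule Max_ge) (use P that in auto)
  have "Z J_words s < \<infinity> \<longleftrightarrow> s > \<tau>" for s
  proof
    assume "s > \<tau>"
    then have "Z (run ij) s < \<infinity>" if "ij \<in> P" for ij using \<sigma>(2) max[OF that] by auto
    then show "Z J_words s < \<infinity>" unfolding J by (intro Z_UN_finite P(1))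
  next
    assume "Z J_words s < \<infinity>"
    moreover have "Z (run ij) s \<le> Z J_words s" by (rule Z_mono) (use J ij in blast)
    ultimately have "Z (run ij) s < \<infinity>" by (rule le_less_trans[rotated])
    then show "s > \<tau>" using \<sigma>(2) ij(2) by simp
  qed
  then show ?thesis using \<sigma>(1) ij(2) by blast
qed

text \<open>Independent of \<open>k\<close>: by \<open>Z_Q_words\<close> it is the common abscissa
  of \<open>f_fun A k\<close> and \<open>g_fun A k\<close> for every \<open>k\<close>.\<close>

definition \<sigma> :: real where
  "\<sigma> = (SOME \<sigma>. \<sigma> \<ge> 0 \<and> (\<forall>s. Z J_words s < \<infinity> \<longleftrightarrow> s > \<sigma>))"

lemma abscissa_nonneg: "\<sigma> \<ge> 0" and Z_J_words: "Z J_words s < \<infinity> \<longleftrightarrow> s > \<sigma>"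
  using someI_ex[OF abscissa_J_words, folded \<sigma>_def] by auto

section \<open>Sums over \<open>Q_words A k\<close> and over constant words\<close>

definition short :: "real \<Rightarrow> 'm list set" where
  "short k = insert [] {r. r \<in> JI \<and> N r \<le> k}"

lemma finite_short: "finite (short k)"
  unfolding short_def using finite_N_le[of k] by (auto intro: finite_subset[rotated])

lemma N_append_short_ge:
  assumes "U \<in> insert [] JI"
  shows "c * N V * N U \<le> N (V @ U)"
proof (cases "U = []")
  case True
  have "c * N V \<le> 1 * N V" by (rule mult_right_mono[OF coefficient_le_1 max_norm_nonneg])
  then show ?thesis using True by (simp add: N_Nil)
next
  case False
  then show ?thesis using assms N_append_ge by auto
qed

lemma N_append_powr_le:
  assumes "U \<in> insert [] JI" "s \<ge> 0"
  shows "N (V @ U) powr (- s) \<le> (c * N U) powr (- s) * N V powr (- s)"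
proof -
  have pos: "c * N U * N V > 0" using coefficient_pos N_pos by simp
  then have "N (V @ U) powr (- s) \<le> (c * N U * N V) powr (- s)"
    using N_append_short_ge[OF assms(1), of V] assms(2) by (intro powr_mono2') (auto simp: mult_ac)
  also have "\<dots> = (c * N U) powr (- s) * N V powr (- s)"
    using coefficient_pos N_pos[of U] N_pos[of V] by (simp add: powr_mult)
  finally show ?thesis .
qed

lemma Z_append_short:
  assumes "Z S s < \<infinity>" "s \<ge> 0"
  shows "Z (\<Union>U\<in>short k. (\<lambda>V. V @ U) ` S) s < \<infinity>"
proof -
  have "Z ((\<lambda>V. V @ U) ` S) s < \<infinity>" if "U \<in> short k" for U
  proof -
    have "U \<in> insert [] JI" using that by (auto simp: short_def)
    then have "Z ((\<lambda>V. V @ U) ` S) s \<le> ennreal ((c * N U) powr (- s)) * Z S s"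
      by (intro Z_image_le N_append_powr_le assms(2)) auto
    also have "\<dots> < \<infinity>" using assms(1) by (simp add: ennreal_mult_less_top)
    finally show ?thesis .
  qed
  then show ?thesis by (intro Z_UN_finite finite_short)
qed

lemma Q_words_props:
  shows N_Q_words: "q \<in> Q_words A k \<Longrightarrow> N q > k"
    and Q_words_JI: "q \<in> Q_words A k \<Longrightarrow> q \<in> JI"
    and Q_words_subset: "Q_words A k \<subseteq> (\<Union>U\<in>short k. (\<lambda>V. V @ U) ` J_words)"
    and J_words_in_Q_words: "J \<in> J_words \<Longrightarrow> N J > k \<Longrightarrow> J \<in> Q_words A k"
    and Q_words_suffix_code: "q \<in> Q_words A k \<Longrightarrow> q' \<in> Q_words A k \<Longrightarrow> W @ q = W' @ q' \<Longrightarrow> q = q'"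
    and Q_words_cover: "(\<exists>i p U. W = replicate p i @ U \<and> U \<in> short k) \<or> (\<exists>W' q. W = W' @ q \<and> q \<in> Q_words A k)"
proof -
  obtain l where l: "Q_words A k = Q_seq A k l" "\<And>q. q \<in> Q_words A k \<Longrightarrow> N q > k"
    using Q_words_eq_Q_seq[OF finite_N_le] by blast
  show "q \<in> Q_words A k \<Longrightarrow> N q > k" by (rule l(2))
  show "q \<in> Q_words A k \<Longrightarrow> q \<in> JI" unfolding l(1) by (rule Q_seq_subset_JI)
  show "Q_words A k \<subseteq> (\<Union>U\<in>short k. (\<lambda>V. V @ U) ` J_words)"
  proof
    fix q assume "q \<in> Q_words A k"
    then have "q \<in> word_prod J_words (short k)" unfolding l(1) short_def by (rule Q_seq_subset)
    then show "q \<in> (\<Union>U\<in>short k. (\<lambda>V. V @ U) ` J_words)" unfolding word_prod_def by blast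
  qed
  show "J \<in> J_words \<Longrightarrow> N J > k \<Longrightarrow> J \<in> Q_words A k" unfolding l(1) by (rule J_words_in_Q_seq)
  show "q \<in> Q_words A k \<Longrightarrow> q' \<in> Q_words A k \<Longrightarrow> W @ q = W' @ q' \<Longrightarrow> q = q'"
    unfolding l(1) by (rule Q_seq_suffix_code)
  show "(\<exists>i p U. W = replicate p i @ U \<and> U \<in> short k) \<or> (\<exists>W' q. W = W' @ q \<and> q \<in> Q_words A k)"
    unfolding l(1) short_def by (rule Q_seq_cover)
qed

text \<open>One direction uses that each of the finitely many tails changes the sum over
  \<open>J_words\<close> by a constant factor, the other that \<open>Q_words A k\<close> contains
  all but finitely many words of \<open>J_words\<close>.\<close>

lemma Z_Q_words: "Z (Q_words A k) s < \<infinity> \<longleftrightarrow> s > \<sigma>"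
proof
  assume "s > \<sigma>"
  then have "Z J_words s < \<infinity>" "s \<ge> 0" using Z_J_words abscissa_nonneg by auto
  then show "Z (Q_words A k) s < \<infinity>"
    using Z_append_short Z_mono[OF Q_words_subset] by (meson le_less_trans)
next
  assume fin: "Z (Q_words A k) s < \<infinity>"
  have "finite {J \<in> J_words. N J \<le> k}" using finite_N_le[of k] by (rule finite_subset[rotated]) auto
  then have "Z {J \<in> J_words. N J \<le> k} s < \<infinity>" by (rule Z_finite)
  with fin have "Z (Q_words A k \<union> {J \<in> J_words. N J \<le> k}) s < \<infinity>" by (rule Z_Un_finite)
  moreover have "Z J_words s \<le> Z (Q_words A k \<union> {J \<in> J_words. N J \<le> k}) s"
    by (rule Z_mono) (use J_words_in_Q_words[of _ k] in force)
  ultimately have "Z J_words s < \<infinity>" by (rule le_less_trans[rotated])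
  then show "s > \<sigma>" using Z_J_words by blast
qed

text \<open>Prefixing a different letter turns a nonempty constant word into a word of
  \<open>J_words\<close> and multiplies its norm by at most a constant. This controls the remainders
  in the covering of all words.\<close>

lemma Z_constant_words:
  assumes "s > \<sigma>"
  shows "Z {replicate p i | p i. True} s < \<infinity>"
proof -
  have s: "s \<ge> 0" using assms abscissa_nonneg by simp
  define R where "R i = range (\<lambda>p. replicate (Suc p) i)" for i :: 'm
  have "Z (R i) s < \<infinity>" for i
  proof -
    obtain i' :: 'm where i': "i' \<noteq> i"
      using letters by (metis (full_types) One_nat_def UNIV_I card.empty card_1_singleton_iff card_le_Suc0_iff_eq finite not_less_eq_eq numeral_2_eq_2)
    \<comment> \<open>Removing the prefix again displays the constant words as an image of
      \<open>J_words\<close> elements, as \<open>Z_image_le\<close> requires.\<close>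
    have tl: "R i = tl ` ((#) i' ` R i)" by (simp add: image_image)
    have le: "Z (tl ` ((#) i' ` R i)) s \<le> ennreal ((real CARD('n) * N [i']) powr s) * Z ((#) i' ` R i) s"
    proof (rule Z_image_le)
      fix V assume "V \<in> (#) i' ` R i"
      then obtain W where W: "V = i' # W" by blast
      have nb: "real CARD('n) * N [i'] > 0" using N_pos by simp
      have "N V \<le> real CARD('n) * N [i'] * N (tl V)" using N_append_le[of "[i']" W] W by simp
      then have "N V / (real CARD('n) * N [i']) \<le> N (tl V)" using nb by (simp add: field_simps)
      then have "N (tl V) powr (- s) \<le> (N V / (real CARD('n) * N [i'])) powr (- s)"
        using s nb N_pos[of V] by (intro powr_mono2') auto
      also have "\<dots> = (real CARD('n) * N [i']) powr s * N V powr (- s)"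
        using nb N_pos[of V] by (simp add: powr_divide powr_minus field_simps)
      finally show "N (tl V) powr (- s) \<le> (real CARD('n) * N [i']) powr s * N V powr (- s)" .
    qed simp
    have "Z ((#) i' ` R i) s \<le> Z J_words s"
      by (rule Z_mono) (use i' in \<open>fastforce simp: R_def J_words_def simp del: replicate_Suc\<close>)
    also have "Z J_words s < \<infinity>" using Z_J_words assms by blast
    finally show ?thesis
      by (subst tl, intro le_less_trans[OF le]) (simp add: ennreal_mult_less_top image_image)
  qed
  then have "Z ((\<Union>i. R i) \<union> {[]}) s < \<infinity>"
    by (intro Z_Un_finite Z_UN_finite Z_finite[of "{[]}"]) simp_all
  moreover have "{replicate p i | p i. True} \<subseteq> (\<Union>i. R i) \<union> {[]}"
  proof
    fix W assume "W \<in> {replicate p i | p i :: 'm. True}"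
    then obtain p i where "W = replicate p i" by blast
    then show "W \<in> (\<Union>i. R i) \<union> {[]}" by (cases p) (auto simp: R_def simp del: replicate_Suc)
  qed
  ultimately show ?thesis using Z_mono by (meson le_less_trans)
qed

section \<open>Comparison of the zeta function with \<open>f_fun\<close> and
  \<open>g_fun\<close>\<close>

lemma f_fun_Z: "f_fun A k s = ennreal (c powr (- s)) * Z (Q_words A k) s"
  by (simp add: f_fun_def Z_def)

lemma g_fun_Z: "g_fun A k s = ennreal (real CARD('n) powr (- s)) * Z (Q_words A k) s"
  by (simp add: g_fun_def Z_def)

lemma zeta_Z: "zeta A s = Z UNIV s"
  by (simp add: zeta_def Z_def)

text \<open>By the suffix code property \<open>(W, q) \<mapsto> W @ q\<close> is injective and misses the empty word, so
  \<open>\<zeta> \<ge> 1 + g \<zeta>\<close>.\<close>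

lemma zeta_infinite:
  assumes "s \<ge> 0" "g_fun A k s \<ge> 1"
  shows "zeta A s = \<infinity>"
proof (rule ccontr)
  assume "zeta A s \<noteq> \<infinity>"
  let ?Q = "Q_words A k" and ?h = "\<lambda>(W, q). W @ q"
  have inj: "inj_on ?h (UNIV \<times> ?Q)"
  proof (rule inj_onI, clarify)
    fix W q W' q' assume q: "q \<in> ?Q" "q' \<in> ?Q" "W @ q = W' @ q'"
    then have "q = q'" by (rule Q_words_suffix_code)
    then show "W = W' \<and> q = q'" using q(3) by simp
  qed
  have nil: "[] \<notin> ?h ` (UNIV \<times> ?Q)"
    using Q_words_JI by (fastforce simp: word_prod_def J_words_def)
  have "g_fun A k s * Z UNIV s = (\<Sum>\<^sub>\<infinity>W. \<Sum>\<^sub>\<infinity>q\<in>?Q. ennreal (real CARD('n) powr (- s) * N W powr (- s) * N q powr (- s)))"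
  proof -
    have "(\<Sum>\<^sub>\<infinity>q\<in>?Q. ennreal (real CARD('n) powr (- s) * N W powr (- s) * N q powr (- s)))
        = g_fun A k s * ennreal (N W powr (- s))" for W
    proof -
      have "(\<Sum>\<^sub>\<infinity>q\<in>?Q. ennreal (real CARD('n) powr (- s) * N W powr (- s) * N q powr (- s)))
          = ennreal (real CARD('n) powr (- s) * N W powr (- s)) * Z ?Q s"
        unfolding Z_def infsum_ennreal_cmult[symmetric] by (simp add: ennreal_mult')
      then show ?thesis unfolding g_fun_Z by (simp add: ennreal_mult' mult_ac)
    qed
    then show ?thesis by (simp add: infsum_ennreal_cmult Z_def)
  qed
  also have "\<dots> \<le> (\<Sum>\<^sub>\<infinity>W. \<Sum>\<^sub>\<infinity>q\<in>?Q. ennreal (N (?h (W, q)) powr (- s)))"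
  proof (intro infsum_ennreal_mono ennreal_leI)
    fix W q
    have "real CARD('n) powr (- s) * N W powr (- s) * N q powr (- s) = (real CARD('n) * N W * N q) powr (- s)"
      using N_pos by (simp add: powr_mult max_norm_nonneg)
    also have "\<dots> \<le> N (?h (W, q)) powr (- s)"
      using N_append_le[of W q] N_pos assms(1) by (simp add: powr_mono2')
    finally show "real CARD('n) powr (- s) * N W powr (- s) * N q powr (- s) \<le> N (?h (W, q)) powr (- s)" .
  qed auto
  also have "\<dots> \<le> (\<Sum>\<^sub>\<infinity>x\<in>UNIV \<times> ?Q. ennreal (N (?h x) powr (- s)))"
    by (rule infsum_ennreal_Times_ge)
  also have "\<dots> = Z (?h ` (UNIV \<times> ?Q)) s"
    unfolding Z_def by (subst infsum_reindex[OF inj]) (simp add: o_def)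
  finally have "g_fun A k s * Z UNIV s \<le> Z (?h ` (UNIV \<times> ?Q)) s" .
  moreover have "1 * Z UNIV s \<le> g_fun A k s * Z UNIV s" by (rule mult_right_mono[OF assms(2)]) simp
  moreover have "1 + Z (?h ` (UNIV \<times> ?Q)) s \<le> Z UNIV s"
  proof -
    have "1 + Z (?h ` (UNIV \<times> ?Q)) s = Z {[]} s + Z (?h ` (UNIV \<times> ?Q)) s"
      by (simp add: Z_def N_Nil)
    also have "\<dots> = Z ({[]} \<union> ?h ` (UNIV \<times> ?Q)) s"
      unfolding Z_def by (rule infsum_Un_disjoint[symmetric]) (use nil in \<open>auto intro: ennreal_summable_on\<close>)
    also have "\<dots> \<le> Z UNIV s" by (rule Z_mono) simp
    finally show ?thesis .
  qed
  ultimately have "1 + 1 * Z UNIV s \<le> Z UNIV s" by (meson add_left_mono order_trans)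
  then have le: "1 + Z UNIV s \<le> Z UNIV s" by simp
  obtain z where z: "Z UNIV s = ennreal z" "z \<ge> 0"
    using \<open>zeta A s \<noteq> \<infinity>\<close> unfolding zeta_Z by (cases "Z UNIV s") auto
  then have "ennreal (1 + z) \<le> ennreal z" using le by simp
  then show False using z(2) by (simp add: ennreal_le_iff del: ennreal_plus)
qed

text \<open>Cutting off the last \<open>Q\<close>-factor gives \<open>Z X \<le> e + f Z X\<close> for the set \<open>X\<close> of words of bounded
  length, with \<open>e\<close> and \<open>f < 1\<close> independent of the bound.\<close>

lemma zeta_finite:
  assumes "s > \<sigma>" "f_fun A k s < 1"
  shows "zeta A s < \<infinity>"
proof -
  let ?Q = "Q_words A k"
  have s: "s \<ge> 0" using assms(1) abscissa_nonneg by simp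
  define E where "E = (\<Union>U\<in>short k. (\<lambda>V. V @ U) ` {replicate p i | p i. True})"
  have "Z E s < \<infinity>" unfolding E_def by (rule Z_append_short[OF Z_constant_words[OF assms(1)] s])
  then obtain e where e: "Z E s = ennreal e" "e \<ge> 0" by (cases "Z E s") auto
  obtain f where f: "f_fun A k s = ennreal f" "f \<ge> 0" "f < 1"
    using assms(2) by (cases "f_fun A k s") (auto simp: ennreal_less_one_iff)
  have bound: "Z {W. length W \<le> L} s \<le> ennreal (e / (1 - f))" for L
  proof -
    \<comment> \<open>Finiteness of \<open>X\<close> makes \<open>Z X s\<close> finite, so
      \<open>f * Z X s\<close> may be subtracted; and \<open>X\<close> is closed under prefixes, so
      the rest left after cutting off a suffix lies in \<open>X\<close> again.\<close>
    define X where "X = {W :: 'm list. length W \<le> L}"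
    have fin: "finite X" unfolding X_def using finite_lists_length_le[of "UNIV :: 'm set" L] by simp
    have sub: "X \<subseteq> E \<union> (\<Union>W\<in>X. (\<lambda>q. W @ q) ` ?Q)"
    proof
      fix W assume W: "W \<in> X"
      from Q_words_cover[of W k] show "W \<in> E \<union> (\<Union>W\<in>X. (\<lambda>q. W @ q) ` ?Q)"
      proof
        assume "\<exists>i p U. W = replicate p i @ U \<and> U \<in> short k"
        then show ?thesis unfolding E_def by blast
      next
        assume "\<exists>W' q. W = W' @ q \<and> q \<in> ?Q"
        then obtain W' q where q: "W = W' @ q" "q \<in> ?Q" by blast
        then have "W' \<in> X" using W by (simp add: X_def)
        then show ?thesis using q by blast
      qed
    qed
    have each: "Z ((\<lambda>q. W @ q) ` ?Q) s \<le> f_fun A k s * ennreal (N W powr (- s))" for W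
    proof -
      have "Z ((\<lambda>q. W @ q) ` ?Q) s \<le> ennreal (c powr (- s) * N W powr (- s)) * Z ?Q s"
      proof (rule Z_image_le)
        fix q assume "q \<in> ?Q"
        then have "N (W @ q) powr (- s) \<le> (c * N q) powr (- s) * N W powr (- s)"
          using Q_words_JI by (intro N_append_powr_le s) blast
        then show "N (W @ q) powr (- s) \<le> c powr (- s) * N W powr (- s) * N q powr (- s)"
          using coefficient_pos N_pos[of q] by (simp add: powr_mult mult_ac)
      qed simp
      then show ?thesis unfolding f_fun_Z by (simp add: ennreal_mult' mult_ac)
    qed
    have "Z X s \<le> Z E s + Z (\<Union>W\<in>X. (\<lambda>q. W @ q) ` ?Q) s"
      using Z_mono[OF sub] Z_Un_le by (meson order_trans)
    also have "\<dots> \<le> Z E s + (\<Sum>W\<in>X. Z ((\<lambda>q. W @ q) ` ?Q) s)"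
      by (intro add_left_mono Z_UN_le fin)
    also have "\<dots> \<le> Z E s + (\<Sum>W\<in>X. f_fun A k s * ennreal (N W powr (- s)))"
      by (intro add_left_mono sum_mono each)
    also have "\<dots> = Z E s + f_fun A k s * Z X s"
      unfolding Z_def infsum_finite[OF fin] sum_distrib_left ..
    finally have le: "Z X s \<le> Z E s + f_fun A k s * Z X s" .
    obtain z where z: "Z X s = ennreal z" "z \<ge> 0"
      using Z_finite[OF fin, of s] by (cases "Z X s") auto
    have "z \<le> e + f * z"
      using le e f z by (simp add: ennreal_mult'[symmetric] ennreal_plus[symmetric] del: ennreal_plus)
    then have "z \<le> e / (1 - f)" using f by (simp add: field_simps)
    then show ?thesis using z unfolding X_def by (simp add: ennreal_leI)
  qed
  have "Z UNIV s \<le> ennreal (e / (1 - f))"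
    unfolding Z_def
  proof (rule infsum_ennreal_le)
    fix F :: "'m list set" assume F: "finite F"
    define L where "L = Max (insert 0 (length ` F))"
    have "F \<subseteq> {W. length W \<le> L}" unfolding L_def using F by (auto intro!: Max_ge)
    then have "(\<Sum>W\<in>F. ennreal (N W powr (- s))) \<le> Z {W. length W \<le> L} s"
      unfolding Z_def by (rule sum_le_infsum_ennreal[OF F])
    then show "(\<Sum>W\<in>F. ennreal (N W powr (- s))) \<le> ennreal (e / (1 - f))"
      using bound by (rule order_trans)
  qed
  then show ?thesis unfolding zeta_Z by (simp add: le_less_trans)
qed

section \<open>Roots of \<open>f_fun\<close> and \<open>g_fun\<close> and their distance\<close>

lemma f_fun_powr_sum: "f_fun A k s = (\<Sum>\<^sub>\<infinity>q\<in>Q_words A k. ennreal ((c * N q) powr (- s)))"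
  unfolding f_fun_def infsum_ennreal_cmult[symmetric]
  using coefficient_pos max_norm_nonneg by (simp add: powr_mult ennreal_mult'[symmetric])

lemma g_fun_powr_sum: "g_fun A k s = (\<Sum>\<^sub>\<infinity>q\<in>Q_words A k. ennreal ((real CARD('n) * N q) powr (- s)))"
  unfolding g_fun_def infsum_ennreal_cmult[symmetric]
  using max_norm_nonneg by (simp add: powr_mult ennreal_mult'[symmetric])

lemma f_fun_finite_iff: "f_fun A k s < \<infinity> \<longleftrightarrow> s > \<sigma>"
  using Z_Q_words[of k s] coefficient_pos by (auto simp: f_fun_Z ennreal_mult_less_top)

lemma g_fun_finite_iff: "g_fun A k s < \<infinity> \<longleftrightarrow> s > \<sigma>"
  using Z_Q_words[of k s] by (auto simp: g_fun_Z ennreal_mult_less_top)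

lemma c_mult_N_ge: "q \<in> Q_words A k \<Longrightarrow> c * k \<le> c * N q"
  using coefficient_pos N_Q_words[of q k] by simp

text \<open>Moving the coefficient inside the power gives the bases \<open>c * N q\<close>, all at
  least \<open>c * k > 1\<close>. For \<open>g_fun\<close> the bases \<open>n * N q\<close> are
  larger still, so one condition on \<open>k\<close> serves both.\<close>

lemma f_fun_unique_root:
  assumes "c * k > 1"
  shows "\<exists>!s. f_fun A k s = 1"
  unfolding f_fun_powr_sum
  by (rule powr_sum_unique_root[OF c_mult_N_ge assms f_fun_finite_iff[unfolded f_fun_powr_sum]])

lemma g_fun_unique_root:
  assumes "c * k > 1"
  shows "\<exists>!s. g_fun A k s = 1"
  unfolding g_fun_powr_sum
proof (rule powr_sum_unique_root[OF _ assms g_fun_finite_iff[unfolded g_fun_powr_sum]])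
  fix q assume "q \<in> Q_words A k"
  then have "c * k \<le> c * N q" by (rule c_mult_N_ge)
  also have "\<dots> \<le> real CARD('n) * N q"
    using coefficient_le_1 n_ge_1 by (intro mult_right_mono max_norm_nonneg) linarith
  finally show "c * k \<le> real CARD('n) * N q" .
qed

lemma f_fun_decay:
  assumes "c * k > 1" "t \<ge> 0"
  shows "f_fun A k (s + t) \<le> ennreal ((c * k) powr (- t)) * f_fun A k s"
  unfolding f_fun_powr_sum using c_mult_N_ge assms by (rule powr_sum_decay)

lemma f_fun_root: "c * k > 1 \<Longrightarrow> f_fun A k (s_f A k) = 1"
  unfolding s_f_def by (rule theI'[OF f_fun_unique_root])

lemma g_fun_root: "c * k > 1 \<Longrightarrow> g_fun A k (s_g A k) = 1"
  unfolding s_g_def by (rule theI'[OF g_fun_unique_root])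

lemma s_f_greater: "c * k > 1 \<Longrightarrow> s_f A k > \<sigma>"
  using f_fun_root f_fun_finite_iff[of k "s_f A k"] by simp

lemma s_g_greater: "c * k > 1 \<Longrightarrow> s_g A k > \<sigma>"
  using g_fun_root g_fun_finite_iff[of k "s_g A k"] by simp

lemma s_g_le_exponent:
  assumes "c * k > 1"
  shows "ereal (s_g A k) \<le> exponent A"
proof -
  have "s_g A k \<ge> 0" using s_g_greater[OF assms] abscissa_nonneg by simp
  moreover have "zeta A (s_g A k) = \<infinity>"
    using zeta_infinite[of "s_g A k" k] g_fun_root[OF assms] \<open>s_g A k \<ge> 0\<close> by simp
  ultimately show ?thesis unfolding exponent_def by (intro Sup_upper) auto
qed

text \<open>To the right of \<open>s_f A k\<close> the decay gives \<open>f_fun A k s < 1\<close>,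
  and there \<open>zeta_finite\<close> applies.\<close>

lemma exponent_le_s_f:
  assumes "c * k > 1"
  shows "exponent A \<le> ereal (s_f A k)"
  unfolding exponent_def
proof (rule Sup_least, clarify)
  fix s assume s: "s \<ge> 0" "zeta A s = \<infinity>"
  show "ereal s \<le> ereal (s_f A k)"
  proof (rule ccontr)
    assume "\<not> ?thesis"
    then have lt: "s_f A k < s" by simp
    have "f_fun A k s \<le> ennreal ((c * k) powr (- (s - s_f A k)))"
      using f_fun_decay[OF assms, of "s - s_f A k" "s_f A k"] lt f_fun_root[OF assms] by simp
    also have "(c * k) powr (- (s - s_f A k)) < 1"
      using powr_less_cancel_iff[of "c * k" "- (s - s_f A k)" 0] assms lt by (auto split: if_splits)
    then have "ennreal ((c * k) powr (- (s - s_f A k))) < 1" by (simp add: ennreal_less_one_iff)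
    finally have "zeta A s < \<infinity>"
      using s_f_greater[OF assms] lt by (intro zeta_finite) auto
    then show False using s(2) by simp
  qed
qed

text \<open>With \<open>t = s_f A k - s_g A k\<close>, decay from \<open>s_g\<close> to
  \<open>s_f\<close> reads \<open>1 \<le> (c * k) powr (- t) * (n / c) powr (s_g A k)\<close>; the
  claim is its logarithm.\<close>

lemma s_f_minus_s_g:
  assumes ck: "c * k > 1"
  shows "(s_f A k - s_g A k) * ln (c * k) \<le> s_g A k * ln (real CARD('n) / c)"
proof -
  define t where "t = s_f A k - s_g A k"
  have "ereal (s_g A k) \<le> ereal (s_f A k)"
    using s_g_le_exponent[OF ck] exponent_le_s_f[OF ck] by (rule order_trans)
  then have t: "t \<ge> 0" by (simp add: t_def)
  define r where "r = real CARD('n) / c"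
  have r: "r > 0" using coefficient_pos n_ge_1 by (simp add: r_def)
  have "c powr (- s_g A k) = r powr (s_g A k) * real CARD('n) powr (- s_g A k)"
    using coefficient_pos n_ge_1 by (simp add: r_def powr_divide powr_minus field_simps)
  then have "f_fun A k (s_g A k) = ennreal (r powr (s_g A k)) * g_fun A k (s_g A k)"
    unfolding f_fun_Z g_fun_Z by (simp add: ennreal_mult' mult.assoc)
  then have "f_fun A k (s_g A k) = ennreal (r powr (s_g A k))" using g_fun_root[OF ck] by simp
  then have "1 \<le> ennreal ((c * k) powr (- t)) * ennreal (r powr (s_g A k))"
    using f_fun_decay[OF ck t, of "s_g A k"] f_fun_root[OF ck] by (simp add: t_def)
  then have "1 \<le> (c * k) powr (- t) * r powr (s_g A k)"
    by (simp add: ennreal_mult'[symmetric] flip: ennreal_1)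
  then have "ln 1 \<le> ln ((c * k) powr (- t) * r powr (s_g A k))"
    using ck r by (subst ln_le_cancel_iff) auto
  also have "\<dots> = - t * ln (c * k) + s_g A k * ln r"
    using ck r by (subst ln_mult) (auto simp: ln_powr)
  finally show ?thesis by (simp add: t_def r_def algebra_simps)
qed

theorem gasket_exponent:
  "0 < exponent A \<and> exponent A < \<infinity> \<and>
    (\<forall>\<^sub>F k in at_top.
       (\<exists>!s. g_fun A k s = 1) \<and> (\<exists>!s. f_fun A k s = 1) \<and>
       ereal (s_g A k) \<le> exponent A \<and> exponent A \<le> ereal (s_f A k)) \<and>
    (s_g A \<longlongrightarrow> real_of_ereal (exponent A)) at_top \<and>
    (s_f A \<longlongrightarrow> real_of_ereal (exponent A)) at_top \<and>
    (\<exists>a>0. \<forall>\<^sub>F k in at_top. \<bar>s_f A k - s_g A k\<bar> \<le> a / ln k)"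
proof -
  have large: "\<forall>\<^sub>F k in at_top. c * k > 1"
    using eventually_gt_at_top[of "1 / c"] by eventually_elim (use coefficient_pos in \<open>simp add: field_simps\<close>)
  then obtain k0 where k0: "c * k0 > 1" by (meson eventually_at_top_linorder order_refl)
  have "ereal 0 < ereal (s_g A k0)" using s_g_greater[OF k0] abscissa_nonneg by simp
  then have pos: "0 < exponent A"
    using s_g_le_exponent[OF k0] unfolding zero_ereal_def by (rule less_le_trans)
  have fin: "exponent A < \<infinity>"
    using exponent_le_s_f[OF k0] by (rule le_less_trans) simp
  obtain e where e: "exponent A = ereal e" using pos fin by (cases "exponent A") auto
  have e0: "e > 0" using pos e by simp
  have bounds: "\<forall>\<^sub>F k in at_top. s_g A k \<le> e \<and> e \<le> s_f A k"
    using large by eventually_elim (use s_g_le_exponent exponent_le_s_f e in simp)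
  \<comment> \<open>The factor 2 pays for replacing \<open>ln (c * k)\<close> by
    \<open>ln k / 2\<close>, the number \<open>e\<close> bounds \<open>s_g A k\<close>, and the
    summand 1 keeps \<open>a\<close> positive when \<open>n / c = 1\<close>.\<close>
  define a where "a = 2 * (e * ln (real CARD('n) / c)) + 1"
  have lnr: "ln (real CARD('n) / c) \<ge> 0"
    using coefficient_pos order_trans[OF coefficient_le_1 n_ge_1]
    by (intro ln_ge_zero) (simp add: field_simps)
  have a: "a > 0" using e0 lnr by (simp add: a_def add_nonneg_pos)
  have speed: "\<forall>\<^sub>F k in at_top. \<bar>s_f A k - s_g A k\<bar> \<le> a / ln k"
    using large bounds eventually_gt_at_top[of 1] eventually_ge_at_top[of "1 / c\<^sup>2"]
  proof eventually_elim
    case (elim k)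
    have k: "k > 1" using elim by simp
    \<comment> \<open>For \<open>k \<ge> 1 / c ^ 2\<close> one has
      \<open>k \<le> (c * k) ^ 2\<close>, hence \<open>ln k / 2 \<le> ln (c * k)\<close>.\<close>
    have "1 \<le> c\<^sup>2 * k" using elim(4) coefficient_pos by (simp add: field_simps)
    then have "k * 1 \<le> k * (c\<^sup>2 * k)" using k by (intro mult_left_mono) auto
    then have "k \<le> (c * k)\<^sup>2" by (simp add: power2_eq_square mult_ac)
    then have "ln k \<le> ln ((c * k)\<^sup>2)" using k by (subst ln_le_cancel_iff) auto
    also have "\<dots> = 2 * ln (c * k)" using elim(1) by (simp add: ln_realpow)
    finally have half: "ln k / 2 \<le> ln (c * k)" by simp
    have d: "s_f A k - s_g A k \<ge> 0" using elim(2) by simp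
    have "(s_f A k - s_g A k) * (ln k / 2) \<le> (s_f A k - s_g A k) * ln (c * k)"
      by (rule mult_left_mono[OF half d])
    also have "\<dots> \<le> s_g A k * ln (real CARD('n) / c)" by (rule s_f_minus_s_g[OF elim(1)])
    also have "\<dots> \<le> e * ln (real CARD('n) / c)" using elim(2) lnr by (intro mult_right_mono) auto
    finally have "(s_f A k - s_g A k) * ln k \<le> a" by (simp add: a_def)
    then show ?case using d k by (simp add: field_simps)
  qed
  have lim0: "((\<lambda>k. a / ln k) \<longlongrightarrow> 0) at_top"
    by (intro tendsto_divide_0[OF tendsto_const] filterlim_at_top_imp_at_infinity ln_at_top)
  have "((\<lambda>k. s_g A k) \<longlongrightarrow> e) at_top"
  proof (rule tendsto_sandwich[where f = "\<lambda>k. e - a / ln k" and h = "\<lambda>k. e"])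
    show "\<forall>\<^sub>F k in at_top. e - a / ln k \<le> s_g A k"
      using speed bounds by eventually_elim linarith
    show "\<forall>\<^sub>F k in at_top. s_g A k \<le> e" using bounds by eventually_elim simp
    show "((\<lambda>k. e - a / ln k) \<longlongrightarrow> e) at_top" using tendsto_diff[OF tendsto_const lim0, of e] by simp
  qed simp
  moreover have "((\<lambda>k. s_f A k) \<longlongrightarrow> e) at_top"
  proof (rule tendsto_sandwich[where f = "\<lambda>k. e" and h = "\<lambda>k. e + a / ln k"])
    show "\<forall>\<^sub>F k in at_top. s_f A k \<le> e + a / ln k"
      using speed bounds by eventually_elim linarith
    show "\<forall>\<^sub>F k in at_top. e \<le> s_f A k" using bounds by eventually_elim simp
    show "((\<lambda>k. e + a / ln k) \<longlongrightarrow> e) at_top" using tendsto_add[OF tendsto_const lim0, of e] by simp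
  qed simp
  moreover have "\<forall>\<^sub>F k in at_top. (\<exists>!s. g_fun A k s = 1) \<and> (\<exists>!s. f_fun A k s = 1) \<and>
       ereal (s_g A k) \<le> exponent A \<and> exponent A \<le> ereal (s_f A k)"
    using large
    by eventually_elim (intro conjI g_fun_unique_root f_fun_unique_root s_g_le_exponent exponent_le_s_f)
  ultimately show ?thesis using pos fin a speed e by auto
qed

end

text \<open>The assumptions besides fastness exclude degenerate cases. For a single letter
  \<open>J_words\<close> is empty, so \<open>f_fun\<close> and \<open>g_fun\<close> vanish and never
  equal 1. With infinite fibres the exponent can be infinite: sending two letters to the 1 by 1
  matrices 1 and 2 gives a fast gasket with infinitely many words of norm 1.\<close>

theorem theorem1:
  assumes "CARD('m::finite) \<ge> 2"
  shows "(\<forall>A :: 'm list \<Rightarrow> real ^ 'n ^ 'n.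
        fast_gasket A \<and> (\<forall>M. finite {I. A I = M}) \<longrightarrow>
          0 < exponent A \<and> exponent A < \<infinity> \<and>
          (\<forall>\<^sub>F k in at_top.
             (\<exists>!s. g_fun A k s = 1) \<and> (\<exists>!s. f_fun A k s = 1) \<and>
             ereal (s_g A k) \<le> exponent A \<and> exponent A \<le> ereal (s_f A k)) \<and>
          (s_g A \<longlongrightarrow> real_of_ereal (exponent A)) at_top \<and>
          (s_f A \<longlongrightarrow> real_of_ereal (exponent A)) at_top \<and>
          (\<exists>a>0. \<forall>\<^sub>F k in at_top. \<bar>s_f A k - s_g A k\<bar> \<le> a / ln k)) \<and>
      (\<forall>A :: 'm list \<Rightarrow> complex ^ 'n ^ 'n.
        fast_gasket A \<and> (\<forall>M. finite {I. A I = M}) \<longrightarrow>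
          0 < exponent A \<and> exponent A < \<infinity> \<and>
          (\<forall>\<^sub>F k in at_top.
             (\<exists>!s. g_fun A k s = 1) \<and> (\<exists>!s. f_fun A k s = 1) \<and>
             ereal (s_g A k) \<le> exponent A \<and> exponent A \<le> ereal (s_f A k)) \<and>
          (s_g A \<longlongrightarrow> real_of_ereal (exponent A)) at_top \<and>
          (s_f A \<longlongrightarrow> real_of_ereal (exponent A)) at_top \<and>
          (\<exists>a>0. \<forall>\<^sub>F k in at_top. \<bar>s_f A k - s_g A k\<bar> \<le> a / ln k))"
  by (rule conjI; rule allI; rule impI; rule finite_fibre_gasket.gasket_exponent; unfold_locales)
    (use assms in auto)

end
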